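(* Let $R$ be a commutative noetherian local ring and let $M$ be a finitely generated $R$-module with $\operatorname{AB-dim}_RM<\infty$. If $\operatorname{Ext}^{i}_R(M,M)=0$ for all $i>0$, then $M$ is free.
   Context: All modules are finitely generated modules over the commutative noetherian local ring $R$. Syzygies and G-dimension. $\Omega^nM$ denotes the $n$th syzygy of $M$ in a minimal free resolution ($\Omega^0M=M$). With $(-)^*=\operatorname{Hom}_R(-,R)$, $M$ is totally reflexive if $M\cong M^{**}$ and $\operatorname{Ext}^{i}_R(M,R)=\operatorname{Ext}^{i}_R(M^*,R)=0$ for all $i>0$. $\operatorname{G-dim}_RM\le n$ (for an integer $n\ge 0$) means that $\Omega^nM$ is totally reflexive; $\operatorname{G-dim}_RM$ is the least such $n\geq 0$, and $\infty$ if there is none. AB-dimension. For $R$-modules $M,N$ put $\operatorname{P}_R(M,N)=\sup\{n\mid \operatorname{Ext}^n_R(M,N)\ne 0\}$ (with $\sup\emptyset=-\infty$). $M^{\perp}$ is the class of all finitely generated $R$-modules $N$ with $\operatorname{Ext}^{i}_R(M,N)=0$ for all $i\gg0$. Put $\operatorname{P}_R(M)=\sup\{\operatorname{P}_R(M,N)\mid N\in M^{\perp}\}$, and $\operatorname{AB-dim}_RM=\sup\{\operatorname{G-dim}_RM,\operatorname{P}_R(M)\}$. *)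

theory Defs
  imports "HOL-Algebra.Algebra" "HOL-Library.Extended_Real"
begin

text \<open>
  Modules are HOL-Algebra modules. The library's module record extends the ring record; its fields
  mult and one play no role in the locale module, and they are filled with arbitrary values below.
\<close>

locale noetherian_local_ring = cring R + noetherian_ring R for R (structure) +
  assumes unique_maximalideal: "\<exists>!I. maximalideal I R"

definition maximal_ideal :: "'a ring \<Rightarrow> 'a set" where
  "maximal_ideal R = (THE I. maximalideal I R)"

definition fg_module :: "'a ring \<Rightarrow> ('a, 'b) module \<Rightarrow> bool" where
  "fg_module R M \<longleftrightarrow> module R M \<and>
     (\<exists>S. finite S \<and> S \<subseteq> carrier M \<and>
        (\<forall>x \<in> carrier M. \<exists>c \<in> S \<rightarrow> carrier R. x = (\<Oplus>\<^bsub>M\<^esub>s\<in>S. c s \<odot>\<^bsub>M\<^esub> s)))"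


section \<open>Homomorphisms\<close>

text \<open>Homomorphisms are extensional, so that equality of homomorphisms is equality in HOL.\<close>

definition mod_hom :: "'a ring \<Rightarrow> ('a, 'b) module \<Rightarrow> ('a, 'c) module \<Rightarrow> ('b \<Rightarrow> 'c) set" where
  "mod_hom R M N = {f \<in> hom (add_monoid M) (add_monoid N) \<inter> extensional (carrier M).
     \<forall>a \<in> carrier R. \<forall>x \<in> carrier M. f (a \<odot>\<^bsub>M\<^esub> x) = a \<odot>\<^bsub>N\<^esub> f x}"

definition mod_iso :: "'a ring \<Rightarrow> ('a, 'b) module \<Rightarrow> ('a, 'c) module \<Rightarrow> bool" where
  "mod_iso R M N \<longleftrightarrow> (\<exists>f \<in> mod_hom R M N. bij_betw f (carrier M) (carrier N))"

definition hom_module ::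
  "'a ring \<Rightarrow> ('a, 'b) module \<Rightarrow> ('a, 'c) module \<Rightarrow> ('a, 'b \<Rightarrow> 'c) module" where
  "hom_module R M N =
     \<lparr>carrier = mod_hom R M N, monoid.mult = undefined, one = undefined,
      ring.zero = (\<lambda>x \<in> carrier M. \<zero>\<^bsub>N\<^esub>),
      ring.add = (\<lambda>f g. \<lambda>x \<in> carrier M. f x \<oplus>\<^bsub>N\<^esub> g x),
      smult = (\<lambda>a f. \<lambda>x \<in> carrier M. a \<odot>\<^bsub>N\<^esub> f x)\<rparr>"

definition self_module :: "'a ring \<Rightarrow> ('a, 'a) module" where
  "self_module R =
     \<lparr>carrier = carrier R, monoid.mult = monoid.mult R, one = one R,
      ring.zero = ring.zero R, ring.add = ring.add R, smult = monoid.mult R\<rparr>"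

definition dual :: "'a ring \<Rightarrow> ('a, 'b) module \<Rightarrow> ('a, 'b \<Rightarrow> 'a) module" where
  "dual R M = hom_module R M (self_module R)"

definition free_module :: "'a ring \<Rightarrow> nat \<Rightarrow> ('a, nat \<Rightarrow> 'a) module" where
  "free_module R n =
     \<lparr>carrier = {..<n} \<rightarrow>\<^sub>E carrier R, monoid.mult = undefined, one = undefined,
      ring.zero = (\<lambda>i \<in> {..<n}. \<zero>\<^bsub>R\<^esub>),
      ring.add = (\<lambda>x y. \<lambda>i \<in> {..<n}. x i \<oplus>\<^bsub>R\<^esub> y i),
      smult = (\<lambda>a x. \<lambda>i \<in> {..<n}. a \<otimes>\<^bsub>R\<^esub> x i)\<rparr>"

text \<open>Freeness is only used for finitely generated modules, where a basis is finite.\<close>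

definition is_free :: "'a ring \<Rightarrow> ('a, 'b) module \<Rightarrow> bool" where
  "is_free R M \<longleftrightarrow> (\<exists>n. mod_iso R (free_module R n) M)"


section \<open>Minimal free resolutions and syzygies\<close>

text \<open>The last condition says that the kernel lies in \<open>\<mm>F\<close>, for \<open>F = R\<^sup>n\<close> and \<open>\<mm>\<close> the maximal ideal.\<close>

definition minimal_free_cover ::
  "'a ring \<Rightarrow> ('a, 'b) module \<Rightarrow> nat \<Rightarrow> ((nat \<Rightarrow> 'a) \<Rightarrow> 'b) \<Rightarrow> bool" where
  "minimal_free_cover R M n p \<longleftrightarrow>
     p \<in> mod_hom R (free_module R n) M \<and>
     p ` carrier (free_module R n) = carrier M \<and>
     a_kernel (free_module R n) M p \<subseteq> {..<n} \<rightarrow>\<^sub>E maximal_ideal R"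

text \<open>
  A minimal free cover exists for every finitely generated module over a noetherian local ring and
  is unique up to isomorphism; one is chosen for each module.
\<close>

definition cover :: "'a ring \<Rightarrow> ('a, 'b) module \<Rightarrow> nat \<times> ((nat \<Rightarrow> 'a) \<Rightarrow> 'b)" where
  "cover R M = (SOME c. minimal_free_cover R M (fst c) (snd c))"

definition first_syzygy :: "'a ring \<Rightarrow> ('a, 'b) module \<Rightarrow> ('a, nat \<Rightarrow> 'a) module" where
  "first_syzygy R M = (let F = free_module R (fst (cover R M)) in
     F\<lparr>carrier := a_kernel F M (snd (cover R M))\<rparr>)"

text \<open>
  The module \<open>syzygy_Suc R M n\<close> is \<open>\<Omega>\<^sup>n\<^sup>+\<^sup>1M\<close>. The index is shifted because \<open>\<Omega>\<^sup>0M = M\<close> has its own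
  carrier type.
\<close>

primrec syzygy_Suc :: "'a ring \<Rightarrow> ('a, 'b) module \<Rightarrow> nat \<Rightarrow> ('a, nat \<Rightarrow> 'a) module" where
  "syzygy_Suc R M 0 = first_syzygy R M"
| "syzygy_Suc R M (Suc n) = first_syzygy R (syzygy_Suc R M n)"

text \<open>
  The minimal free resolution of \<open>M\<close> spliced from the chosen covers:
  \<open>res_diff R M n\<close> is the differential \<open>F\<^sub>n\<^sub>+\<^sub>1 \<rightarrow> F\<^sub>n\<close>, whose image is \<open>\<Omega>\<^sup>n\<^sup>+\<^sup>1M \<subseteq> F\<^sub>n\<close>.
\<close>

definition res_module :: "'a ring \<Rightarrow> ('a, 'b) module \<Rightarrow> nat \<Rightarrow> ('a, nat \<Rightarrow> 'a) module" where
  "res_module R M n = free_module R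
     (case n of 0 \<Rightarrow> fst (cover R M) | Suc k \<Rightarrow> fst (cover R (syzygy_Suc R M k)))"

definition res_diff :: "'a ring \<Rightarrow> ('a, 'b) module \<Rightarrow> nat \<Rightarrow> (nat \<Rightarrow> 'a) \<Rightarrow> (nat \<Rightarrow> 'a)" where
  "res_diff R M n = snd (cover R (syzygy_Suc R M n))"


section \<open>Ext\<close>

text \<open>\<open>Ext R n M N\<close> is the \<open>n\<close>-th cohomology group of the complex \<open>Hom(F, N)\<close>, with \<open>F\<close> as above.\<close>

definition cochains ::
  "'a ring \<Rightarrow> ('a, 'b) module \<Rightarrow> ('a, 'c) module \<Rightarrow> nat \<Rightarrow> ('a, (nat \<Rightarrow> 'a) \<Rightarrow> 'c) module" where
  "cochains R M N n = hom_module R (res_module R M n) N"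

definition coboundary ::
  "'a ring \<Rightarrow> ('a, 'b) module \<Rightarrow> nat \<Rightarrow> ((nat \<Rightarrow> 'a) \<Rightarrow> 'c) \<Rightarrow> ((nat \<Rightarrow> 'a) \<Rightarrow> 'c)" where
  "coboundary R M n f = compose (carrier (res_module R M (Suc n))) f (res_diff R M n)"

definition cocycles ::
  "'a ring \<Rightarrow> ('a, 'b) module \<Rightarrow> ('a, 'c) module \<Rightarrow> nat \<Rightarrow> ((nat \<Rightarrow> 'a) \<Rightarrow> 'c) set" where
  "cocycles R M N n =
     a_kernel (cochains R M N n) (cochains R M N (Suc n)) (coboundary R M n)"

definition coboundaries ::
  "'a ring \<Rightarrow> ('a, 'b) module \<Rightarrow> ('a, 'c) module \<Rightarrow> nat \<Rightarrow> ((nat \<Rightarrow> 'a) \<Rightarrow> 'c) set" where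
  "coboundaries R M N n = (case n of
     0 \<Rightarrow> {\<zero>\<^bsub>cochains R M N 0\<^esub>}
   | Suc k \<Rightarrow> coboundary R M k ` carrier (cochains R M N k))"

definition Ext ::
  "'a ring \<Rightarrow> nat \<Rightarrow> ('a, 'b) module \<Rightarrow> ('a, 'c) module \<Rightarrow> ((nat \<Rightarrow> 'a) \<Rightarrow> 'c) set monoid" where
  "Ext R n M N =
     (add_monoid (cochains R M N n))\<lparr>carrier := cocycles R M N n\<rparr> Mod coboundaries R M N n"

abbreviation Ext_zero :: "'a ring \<Rightarrow> nat \<Rightarrow> ('a, 'b) module \<Rightarrow> ('a, 'c) module \<Rightarrow> bool" where
  "Ext_zero R n M N \<equiv> trivial_group (Ext R n M N)"


section \<open>G-dimension and AB-dimension\<close>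

definition totally_reflexive :: "'a ring \<Rightarrow> ('a, 'b) module \<Rightarrow> bool" where
  "totally_reflexive R M \<longleftrightarrow>
     mod_iso R M (dual R (dual R M)) \<and>
     (\<forall>i>0. Ext_zero R i M (self_module R) \<and> Ext_zero R i (dual R M) (self_module R))"

definition G_dim_le :: "'a ring \<Rightarrow> ('a, 'b) module \<Rightarrow> nat \<Rightarrow> bool" where
  "G_dim_le R M n \<longleftrightarrow> (case n of
     0 \<Rightarrow> totally_reflexive R M | Suc k \<Rightarrow> totally_reflexive R (syzygy_Suc R M k))"

text \<open>In \<open>ereal\<close>, the infimum of the empty set is \<open>\<infinity>\<close> and its supremum is \<open>-\<infinity>\<close>.\<close>

definition G_dim :: "'a ring \<Rightarrow> ('a, 'b) module \<Rightarrow> ereal" where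
  "G_dim R M = (INF n \<in> {n. G_dim_le R M n}. ereal (real n))"

definition P2 :: "'a ring \<Rightarrow> ('a, 'b) module \<Rightarrow> ('a, 'c) module \<Rightarrow> ereal" where
  "P2 R M N = (SUP n \<in> {n. \<not> Ext_zero R n M N}. ereal (real n))"

text \<open>
  The class \<open>M\<^sup>\<bottom>\<close> is represented by its members with carrier in \<open>nat \<Rightarrow> 'a\<close>. Nothing is lost: by
  \<open>fg_module_small\<close> below, every finitely generated module is isomorphic to one of these.
\<close>

definition perp :: "'a ring \<Rightarrow> ('a, 'b) module \<Rightarrow> ('a, nat \<Rightarrow> 'a) module set" where
  "perp R M = {N. fg_module R N \<and> (\<exists>k. \<forall>i\<ge>k. Ext_zero R i M N)}"

definition P1 :: "'a ring \<Rightarrow> ('a, 'b) module \<Rightarrow> ereal" where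
  "P1 R M = (SUP N \<in> perp R M. P2 R M N)"

definition AB_dim :: "'a ring \<Rightarrow> ('a, 'b) module \<Rightarrow> ereal" where
  "AB_dim R M = max (G_dim R M) (P1 R M)"

lemma fg_module_small:
  fixes R :: "'a ring" and M :: "('a, 'b) module"
  assumes "fg_module R M"
  shows "\<exists>N :: ('a, nat \<Rightarrow> 'a) module. fg_module R N \<and> mod_iso R M N"
proof -
  interpret M: module R M using assms by (simp add: fg_module_def)
  obtain S where S: "finite S" "S \<subseteq> carrier M"
    and gen: "\<forall>x \<in> carrier M. \<exists>c \<in> S \<rightarrow> carrier R. x = (\<Oplus>\<^bsub>M\<^esub>s\<in>S. c s \<odot>\<^bsub>M\<^esub> s)"
    using assms unfolding fg_module_def by blast
  obtain c where c: "\<And>x. x \<in> carrier M \<Longrightarrow> c x \<in> S \<rightarrow> carrier R"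
    and cx: "\<And>x. x \<in> carrier M \<Longrightarrow> x = (\<Oplus>\<^bsub>M\<^esub>s\<in>S. c x s \<odot>\<^bsub>M\<^esub> s)"
    using gen by metis
  define e where "e = from_nat_into S"
  define g where "g = (\<lambda>x (i::nat). c x (e i))"
  have cnt: "countable S" using S(1) by (rule countable_finite)
  have inj: "inj_on g (carrier M)"
  proof (rule inj_onI)
    fix x y assume x: "x \<in> carrier M" and y: "y \<in> carrier M" and eq: "g x = g y"
    have "c x s = c y s" if "s \<in> S" for s
      using fun_cong[OF eq, of "to_nat_on S s"] that cnt by (simp add: g_def e_def)
    then have "(\<Oplus>\<^bsub>M\<^esub>s\<in>S. c x s \<odot>\<^bsub>M\<^esub> s) = (\<Oplus>\<^bsub>M\<^esub>s\<in>S. c y s \<odot>\<^bsub>M\<^esub> s)"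
      using c[OF y] S(2) by (intro M.finsum_cong') (auto simp: Pi_def)
    then show "x = y" using cx[OF x] cx[OF y] by simp
  qed
  define h where "h = inv_into (carrier M) g"
  have hg [simp]: "h (g x) = x" if "x \<in> carrier M" for x
    using inj that by (simp add: h_def)
  define N :: "('a, nat \<Rightarrow> 'a) module" where
    "N = \<lparr>carrier = g ` carrier M, monoid.mult = undefined, one = undefined,
          ring.zero = g \<zero>\<^bsub>M\<^esub>,
          ring.add = (\<lambda>x y. g (h x \<oplus>\<^bsub>M\<^esub> h y)), smult = (\<lambda>a x. g (a \<odot>\<^bsub>M\<^esub> h x))\<rparr>"
  have N [simp]: "carrier N = g ` carrier M" "\<zero>\<^bsub>N\<^esub> = g \<zero>\<^bsub>M\<^esub>"
    "x \<oplus>\<^bsub>N\<^esub> y = g (h x \<oplus>\<^bsub>M\<^esub> h y)" "a \<odot>\<^bsub>N\<^esub> x = g (a \<odot>\<^bsub>M\<^esub> h x)" for x y a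
    by (simp_all add: N_def)
  have agN: "abelian_group N"
  proof (rule abelian_groupI)
    fix x assume "x \<in> carrier N"
    then show "\<exists>y\<in>carrier N. y \<oplus>\<^bsub>N\<^esub> x = \<zero>\<^bsub>N\<^esub>"
      by (auto intro!: bexI[of _ "\<ominus>\<^bsub>M\<^esub> _"] simp: M.l_neg)
  qed (auto simp: M.a_ac)
  have modN: "module R N"
    by (rule moduleI) (auto simp: M.is_cring agN M.smult_l_distr M.smult_r_distr M.smult_assoc1)
  interpret N: module R N by (fact modN)
  have sum: "g (\<Oplus>\<^bsub>M\<^esub>s\<in>A. f s) = (\<Oplus>\<^bsub>N\<^esub>s\<in>A. g (f s))"
    if "finite A" "f \<in> A \<rightarrow> carrier M" for A and f :: "'b \<Rightarrow> 'b"
    using that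
  proof (induction A)
    case (insert a A)
    then have "h (\<Oplus>\<^bsub>N\<^esub>s\<in>A. g (f s)) = (\<Oplus>\<^bsub>M\<^esub>s\<in>A. f s)"
      using hg[of "\<Oplus>\<^bsub>M\<^esub>s\<in>A. f s"] by auto
    with insert show ?case by (auto simp: Pi_def)
  qed simp
  have genN: "\<exists>d \<in> g ` S \<rightarrow> carrier R. y = (\<Oplus>\<^bsub>N\<^esub>t\<in>g ` S. d t \<odot>\<^bsub>N\<^esub> t)"
    if y: "y \<in> carrier N" for y
  proof -
    obtain x where x: "x \<in> carrier M" "y = g x" using y by auto
    have injS: "inj_on g S" using inj S(2) by (rule inj_on_subset)
    have sm: "c x s \<odot>\<^bsub>M\<^esub> s \<in> carrier M" if "s \<in> S" for s
      using c[OF x(1)] that S(2) by auto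
    have hS: "h (g s) = s" if "s \<in> S" for s using that S(2) by auto
    have "y = (\<Oplus>\<^bsub>N\<^esub>s\<in>S. g (c x s \<odot>\<^bsub>M\<^esub> s))"
      using sum[of S "\<lambda>s. c x s \<odot>\<^bsub>M\<^esub> s"] cx[OF x(1)] S(1) sm x(2) by auto
    also have "\<dots> = (\<Oplus>\<^bsub>N\<^esub>s\<in>S. c x (h (g s)) \<odot>\<^bsub>N\<^esub> g s)"
      by (rule N.finsum_cong') (use sm hS in auto)
    also have "\<dots> = (\<Oplus>\<^bsub>N\<^esub>t\<in>g ` S. c x (h t) \<odot>\<^bsub>N\<^esub> t)"
      by (rule N.finsum_reindex[symmetric]) (use sm hS injS in auto)
    finally show ?thesis
      using c[OF x(1)] hS by (intro bexI[of _ "\<lambda>t. c x (h t)"]) auto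
  qed
  have "fg_module R N"
    unfolding fg_module_def using modN S genN by (intro conjI exI[of _ "g ` S"]) auto
  moreover have "mod_iso R M N"
    unfolding mod_iso_def
  proof (rule bexI)
    show "bij_betw (restrict g (carrier M)) (carrier M) (carrier N)"
      using inj by (simp add: bij_betw_def)
    show "restrict g (carrier M) \<in> mod_hom R M N"
      by (auto simp: mod_hom_def hom_def)
  qed
  ultimately show ?thesis by blast
qed

end

theory Submission
  imports Defs
begin

text \<open>
  Let \<open>\<mm>\<close> be the maximal ideal, \<open>F\<close> the minimal free resolution of \<open>M\<close>, and \<open>\<Omega>\<^sup>nM\<close> totally
  reflexive. The proof plays the syzygies \<open>\<Omega>\<^sup>jM\<close> against \<open>M\<close> as second arguments of Ext.

  Since \<open>Ext\<^sup>i(M, R) = Ext\<^sup>i\<^sup>-\<^sup>n(\<Omega>\<^sup>nM, R) = 0\<close> for \<open>i > n\<close>, the sequence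
  \<open>0 \<rightarrow> \<Omega>N \<rightarrow> R\<^sup>k \<rightarrow> N \<rightarrow> 0\<close> shows that \<open>Ext\<^sup>i(M, N)\<close> and \<open>Ext\<^sup>i\<^sup>+\<^sup>1(M, \<Omega>N)\<close> vanish together for
  \<open>i > n\<close> (\<open>Ext_zero_shift\<close>). Starting from \<open>Ext\<^sup>i(M, M) = 0\<close> one finds \<open>Ext\<^sup>i(M, \<Omega>\<^sup>jM) = 0\<close> for
  \<open>i > n + j\<close>, so all \<open>\<Omega>\<^sup>jM\<close> lie in \<open>M\<^sup>\<bottom>\<close>. Finite AB-dimension now provides a number \<open>b\<close> with
  \<open>Ext\<^sup>i(M, \<Omega>\<^sup>jM) = 0\<close> for all \<open>i \<ge> b\<close> and all \<open>j\<close>. In particular \<open>Ext\<^sup>i(M, \<Omega>\<^sup>iM) = 0\<close> for large \<open>i\<close>,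
  and shifting back down gives \<open>Ext\<^sup>i(M, \<Omega>\<^sup>iM) = 0\<close> for \<open>i = n + 1\<close>.

  This last group contains the class of \<open>F\<^sub>n\<^sub>+\<^sub>1 \<rightarrow> \<Omega>\<^sup>n\<^sup>+\<^sup>1M\<close>. Its vanishing means that the inclusion
  \<open>\<Omega>\<^sup>n\<^sup>+\<^sup>1M \<subseteq> F\<^sub>n\<close> splits; but its image lies in \<open>\<mm>F\<^sub>n\<close>, so \<open>\<Omega>\<^sup>n\<^sup>+\<^sup>1M = 0\<close> by Nakayama's lemma
  (\<open>syzygy_vanishes_if_split\<close>), and \<open>M\<close> has a finite free resolution. If its last term \<open>F\<^sub>k\<close> had
  \<open>k > 0\<close>, then all maps \<open>F\<^sub>k \<rightarrow> M\<close> would be cocycles, while coboundaries have values in \<open>\<mm>M\<close>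
  by minimality; then \<open>Ext\<^sup>k(M, M) = 0\<close> would imply \<open>M = \<mm>M\<close>, hence \<open>M = 0\<close>
  (\<open>res_rank_descend\<close>). So \<open>M\<close> is isomorphic to \<open>F\<^sub>0\<close>.

  All of this is carried out with maps out of free modules: vanishing of Ext is an extension
  property for the differentials (\<open>Ext_zero_iff_extends\<close>), and Nakayama's lemma is a property of
  minimal covers (\<open>minimal_free_cover_basis_image\<close>).
\<close>

section \<open>Homomorphisms of modules\<close>

text \<open>
  The library's locales allow any extension of the ring record; homomorphisms and resolutions are
  defined for plain rings.
\<close>

locale base_ring = cring R for R :: "'a ring" (structure)

lemma mod_homI:
  assumes "\<And>x. x \<in> carrier M \<Longrightarrow> f x \<in> carrier N"
    and "f \<in> extensional (carrier M)"
    and "\<And>x y. x \<in> carrier M \<Longrightarrow> y \<in> carrier M \<Longrightarrow> f (x \<oplus>\<^bsub>M\<^esub> y) = f x \<oplus>\<^bsub>N\<^esub> f y"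
    and "\<And>a x. a \<in> carrier R \<Longrightarrow> x \<in> carrier M \<Longrightarrow> f (a \<odot>\<^bsub>M\<^esub> x) = a \<odot>\<^bsub>N\<^esub> f x"
  shows "f \<in> mod_hom R M N"
  using assms by (auto simp: mod_hom_def hom_def)

lemma mod_homD:
  assumes "f \<in> mod_hom R M N"
  shows mod_hom_closed: "x \<in> carrier M \<Longrightarrow> f x \<in> carrier N"
    and mod_hom_extensional: "f \<in> extensional (carrier M)"
    and mod_hom_add: "x \<in> carrier M \<Longrightarrow> y \<in> carrier M \<Longrightarrow> f (x \<oplus>\<^bsub>M\<^esub> y) = f x \<oplus>\<^bsub>N\<^esub> f y"
    and mod_hom_smult: "a \<in> carrier R \<Longrightarrow> x \<in> carrier M \<Longrightarrow> f (a \<odot>\<^bsub>M\<^esub> x) = a \<odot>\<^bsub>N\<^esub> f x"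
  using assms by (auto simp: mod_hom_def hom_def)

lemma mod_hom_abelian_group_hom:
  assumes "module R M" "module R N" "f \<in> mod_hom R M N"
  shows "abelian_group_hom M N f"
  using assms
  by (intro abelian_group_homI)
     (auto simp: module_def mod_hom_def group_hom_def group_hom_axioms_def
       intro: abelian_group.a_group)

lemma mod_hom_zero:
  assumes "module R M" "module R N" "f \<in> mod_hom R M N"
  shows "f \<zero>\<^bsub>M\<^esub> = \<zero>\<^bsub>N\<^esub>"
  using abelian_group_hom.hom_zero[OF mod_hom_abelian_group_hom[OF assms]] .

lemma mod_hom_minus:
  assumes "module R M" "module R N" "f \<in> mod_hom R M N" "x \<in> carrier M" "y \<in> carrier M"
  shows "f (x \<ominus>\<^bsub>M\<^esub> y) = f x \<ominus>\<^bsub>N\<^esub> f y"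
proof -
  interpret abelian_group_hom M N f by (rule mod_hom_abelian_group_hom[OF assms(1-3)])
  show ?thesis using assms(4,5) by (simp add: a_minus_def)
qed

lemma mod_hom_finsum:
  assumes "module R M" "module R N" "f \<in> mod_hom R M N" "finite A" "x \<in> A \<rightarrow> carrier M"
  shows "f (\<Oplus>\<^bsub>M\<^esub>i\<in>A. x i) = (\<Oplus>\<^bsub>N\<^esub>i\<in>A. f (x i))"
proof -
  interpret M: module R M by fact
  interpret N: module R N by fact
  show ?thesis
    using assms(4,5)
  proof (induction A)
    case empty
    then show ?case by (simp add: mod_hom_zero[OF assms(1-3)])
  next
    case (insert a A)
    then show ?case
      by (simp add: mod_hom_add[OF assms(3)] mod_hom_closed[OF assms(3)] Pi_def)
  qed
qed

lemma mod_hom_compose: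
  assumes L: "module R L" and f: "f \<in> mod_hom R L M" and g: "g \<in> mod_hom R M N"
  shows "compose (carrier L) g f \<in> mod_hom R L N"
proof -
  interpret L: module R L by fact
  show ?thesis
    by (rule mod_homI)
       (simp_all add: compose_def mod_homD(1,3,4)[OF f] mod_homD(1,3,4)[OF g])
qed

lemma mod_hom_diff:
  assumes L: "module R L" and N: "module R N" and f: "f \<in> mod_hom R L N" and g: "g \<in> mod_hom R L N"
  shows "(\<lambda>x\<in>carrier L. f x \<ominus>\<^bsub>N\<^esub> g x) \<in> mod_hom R L N"
proof -
  interpret L: module R L by fact
  interpret N: module R N by fact
  note fg = mod_homD[OF f] mod_homD[OF g]
  show ?thesis
  proof (rule mod_homI)
    fix x y assume x: "x \<in> carrier L" and y: "y \<in> carrier L"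
    have c: "f x \<in> carrier N" "f y \<in> carrier N" "g x \<in> carrier N" "g y \<in> carrier N"
      using x y fg by auto
    then show "(\<lambda>x\<in>carrier L. f x \<ominus>\<^bsub>N\<^esub> g x) x \<in> carrier N" using x by simp
    have "f x \<oplus>\<^bsub>N\<^esub> f y \<ominus>\<^bsub>N\<^esub> (g x \<oplus>\<^bsub>N\<^esub> g y) = f x \<ominus>\<^bsub>N\<^esub> g x \<oplus>\<^bsub>N\<^esub> (f y \<ominus>\<^bsub>N\<^esub> g y)"
      using c by (simp add: a_minus_def N.minus_add N.a_ac)
    then show "(\<lambda>x\<in>carrier L. f x \<ominus>\<^bsub>N\<^esub> g x) (x \<oplus>\<^bsub>L\<^esub> y) =
        (\<lambda>x\<in>carrier L. f x \<ominus>\<^bsub>N\<^esub> g x) x \<oplus>\<^bsub>N\<^esub> (\<lambda>x\<in>carrier L. f x \<ominus>\<^bsub>N\<^esub> g x) y"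
      using x y by (simp add: mod_hom_add[OF f] mod_hom_add[OF g])
  next
    fix a x assume a: "a \<in> carrier R" and x: "x \<in> carrier L"
    then have "f x \<in> carrier N" "g x \<in> carrier N" using fg by auto
    then show "(\<lambda>x\<in>carrier L. f x \<ominus>\<^bsub>N\<^esub> g x) (a \<odot>\<^bsub>L\<^esub> x) =
        a \<odot>\<^bsub>N\<^esub> (\<lambda>x\<in>carrier L. f x \<ominus>\<^bsub>N\<^esub> g x) x"
      using a x by (simp add: mod_hom_smult[OF f] mod_hom_smult[OF g] a_minus_def
          N.smult_r_distr N.smult_r_minus)
  qed simp
qed

text \<open>Operations of a submodule are those of the ambient module, so only the range matters.\<close>

lemma mod_hom_submodule_iff:
  "f \<in> mod_hom R M (N\<lparr>carrier := H\<rparr>) \<longleftrightarrow>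
     f \<in> extensional (carrier M) \<and> f ` carrier M \<subseteq> H \<and>
     (\<forall>x\<in>carrier M. \<forall>y\<in>carrier M. f (x \<oplus>\<^bsub>M\<^esub> y) = f x \<oplus>\<^bsub>N\<^esub> f y) \<and>
     (\<forall>a\<in>carrier R. \<forall>x\<in>carrier M. f (a \<odot>\<^bsub>M\<^esub> x) = a \<odot>\<^bsub>N\<^esub> f x)"
  by (auto simp: mod_hom_def hom_def)

lemma mod_hom_into_submodule:
  assumes "f \<in> mod_hom R M N" "\<And>x. x \<in> carrier M \<Longrightarrow> f x \<in> H"
  shows "f \<in> mod_hom R M (N\<lparr>carrier := H\<rparr>)"
  using assms by (auto simp: mod_hom_submodule_iff dest: mod_homD)

lemma mod_hom_from_submodule:
  assumes "f \<in> mod_hom R M (N\<lparr>carrier := H\<rparr>)" "H \<subseteq> carrier N"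
  shows "f \<in> mod_hom R M N"
  using assms by (auto simp: mod_hom_submodule_iff intro!: mod_homI)

lemma kernel_submodule:
  assumes "module R M" "module R N" "f \<in> mod_hom R M N"
  shows "submodule (a_kernel M N f) R M"
proof -
  interpret M: module R M by fact
  interpret N: module R N by fact
  interpret abelian_group_hom M N f by (rule mod_hom_abelian_group_hom[OF assms])
  show ?thesis
    unfolding a_kernel_def'
  proof (rule M.submoduleI)
    fix a x assume "a \<in> carrier R" "x \<in> {x \<in> carrier M. f x = \<zero>\<^bsub>N\<^esub>}"
    then show "a \<odot>\<^bsub>M\<^esub> x \<in> {x \<in> carrier M. f x = \<zero>\<^bsub>N\<^esub>}"
      using mod_hom_smult[OF assms(3), of a x] N.smult_r_null[of a] by simp
  qed (simp_all add: subset_iff)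
qed

lemma image_submodule:
  assumes "module R M" "module R N" "f \<in> mod_hom R M N" "submodule H R M"
  shows "submodule (f ` H) R N"
proof -
  interpret M: module R M by fact
  interpret N: module R N by fact
  interpret abelian_group_hom M N f by (rule mod_hom_abelian_group_hom[OF assms(1-3)])
  note H = M.submoduleE[OF assms(4)]
  have inH: "x \<in> carrier M" if "x \<in> H" for x using H(1) that by auto
  show ?thesis
  proof (rule N.submoduleI)
    show "f ` H \<subseteq> carrier N" using inH by auto
    have "\<zero>\<^bsub>M\<^esub> \<in> H" using subgroup.one_closed[OF submodule.axioms(1)[OF assms(4)]] by simp
    then show "\<zero>\<^bsub>N\<^esub> \<in> f ` H" using hom_zero by (metis imageI)
  next
    fix a assume "a \<in> f ` H"
    then obtain x where x: "x \<in> H" "a = f x" by auto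
    then have "\<ominus>\<^bsub>N\<^esub> a = f (\<ominus>\<^bsub>M\<^esub> x)" using inH by simp
    then show "\<ominus>\<^bsub>N\<^esub> a \<in> f ` H" using H(3) x by auto
  next
    fix a b assume "a \<in> f ` H" "b \<in> f ` H"
    then obtain x y where x: "x \<in> H" "a = f x" and y: "y \<in> H" "b = f y" by auto
    then have "a \<oplus>\<^bsub>N\<^esub> b = f (x \<oplus>\<^bsub>M\<^esub> y)" using inH by simp
    then show "a \<oplus>\<^bsub>N\<^esub> b \<in> f ` H" using H(5) x y by auto
  next
    fix a b assume a: "a \<in> carrier R" and "b \<in> f ` H"
    then obtain x where x: "x \<in> H" "b = f x" by auto
    then have "a \<odot>\<^bsub>N\<^esub> b = f (a \<odot>\<^bsub>M\<^esub> x)" using inH a by (simp add: mod_hom_smult[OF assms(3)])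
    then show "a \<odot>\<^bsub>N\<^esub> b \<in> f ` H" using H(4) x a by auto
  qed
qed

section \<open>Free modules\<close>

lemma free_module_simps [simp]:
  "carrier (free_module R n) = {..<n} \<rightarrow>\<^sub>E carrier R"
  "\<zero>\<^bsub>free_module R n\<^esub> = (\<lambda>i\<in>{..<n}. \<zero>\<^bsub>R\<^esub>)"
  "x \<oplus>\<^bsub>free_module R n\<^esub> y = (\<lambda>i\<in>{..<n}. x i \<oplus>\<^bsub>R\<^esub> y i)"
  "a \<odot>\<^bsub>free_module R n\<^esub> x = (\<lambda>i\<in>{..<n}. a \<otimes>\<^bsub>R\<^esub> x i)"
  by (simp_all add: free_module_def)

lemma self_module_simps [simp]:
  "carrier (self_module R) = carrier R" "\<zero>\<^bsub>self_module R\<^esub> = \<zero>\<^bsub>R\<^esub>"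
  "x \<oplus>\<^bsub>self_module R\<^esub> y = x \<oplus>\<^bsub>R\<^esub> y" "a \<odot>\<^bsub>self_module R\<^esub> x = a \<otimes>\<^bsub>R\<^esub> x"
  by (simp_all add: self_module_def)

context base_ring
begin

lemma free_module_module: "module R (free_module R n)"
proof -
  have "abelian_group (free_module R n)"
  proof (rule abelian_groupI)
    fix x assume x: "x \<in> carrier (free_module R n)"
    then show "\<exists>y\<in>carrier (free_module R n). y \<oplus>\<^bsub>free_module R n\<^esub> x = \<zero>\<^bsub>free_module R n\<^esub>"
      by (intro bexI[of _ "\<lambda>i\<in>{..<n}. \<ominus> x i"]) (auto simp: l_neg PiE_iff intro!: restrict_ext)
  qed (auto simp: PiE_iff extensional_def a_ac fun_eq_iff)
  then show ?thesis
    by (intro moduleI)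
       (auto simp: PiE_iff extensional_def fun_eq_iff l_distr r_distr m_assoc intro: cring_axioms)
qed

lemma self_module_module: "module R (self_module R)"
proof -
  have "abelian_group (self_module R)"
  proof (rule abelian_groupI)
    fix x assume x: "x \<in> carrier (self_module R)"
    then show "\<exists>y\<in>carrier (self_module R). y \<oplus>\<^bsub>self_module R\<^esub> x = \<zero>\<^bsub>self_module R\<^esub>"
      by (intro bexI[of _ "\<ominus> x"]) (auto simp: l_neg)
  qed (auto simp: a_ac)
  then show ?thesis
    by (intro moduleI) (auto simp: l_distr r_distr m_assoc intro: cring_axioms)
qed

lemma coordinate_mod_hom:
  assumes "i < n"
  shows "(\<lambda>x\<in>carrier (free_module R n). x i) \<in> mod_hom R (free_module R n) (self_module R)"
  using assms by (intro mod_homI) (auto simp: PiE_iff extensional_def)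

lemma finsum_free_module_apply:
  assumes "finite A" "x \<in> A \<rightarrow> carrier (free_module R n)" "k < n"
  shows "(\<Oplus>\<^bsub>free_module R n\<^esub>i\<in>A. x i) k = (\<Oplus>i\<in>A. x i k)"
proof -
  interpret F: module R "free_module R n" by (rule free_module_module)
  show ?thesis
    using assms(1,2)
  proof (induction A)
    case empty
    then show ?case using assms(3) by simp
  next
    case (insert a A)
    have "x i k \<in> carrier R" if "i \<in> insert a A" for i
      using insert.prems assms(3) that by (auto simp: PiE_iff Pi_iff)
    with insert assms(3) show ?case by (simp add: Pi_iff)
  qed
qed

definition unit_vec :: "nat \<Rightarrow> nat \<Rightarrow> nat \<Rightarrow> 'a" where
  "unit_vec n i = (\<lambda>j\<in>{..<n}. if j = i then \<one> else \<zero>)"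

lemma unit_vec_closed [simp]: "unit_vec n i \<in> {..<n} \<rightarrow>\<^sub>E carrier R"
  by (auto simp: unit_vec_def)

lemma free_module_expand:
  assumes a: "a \<in> carrier (free_module R n)"
  shows "a = (\<Oplus>\<^bsub>free_module R n\<^esub>i\<in>{..<n}. a i \<odot>\<^bsub>free_module R n\<^esub> unit_vec n i)"
proof -
  interpret F: module R "free_module R n" by (rule free_module_module)
  have ai: "a i \<in> carrier R" if "i < n" for i using a that by (auto simp: PiE_iff)
  have mem: "(\<lambda>i. a i \<odot>\<^bsub>free_module R n\<^esub> unit_vec n i) \<in> {..<n} \<rightarrow> carrier (free_module R n)"
    using ai by (intro Pi_I F.smult_closed) auto
  show ?thesis
  proof (rule extensionalityI[of _ "{..<n}"])
    show "a \<in> extensional {..<n}" using a by (auto simp: PiE_iff)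
    show "(\<Oplus>\<^bsub>free_module R n\<^esub>i\<in>{..<n}. a i \<odot>\<^bsub>free_module R n\<^esub> unit_vec n i) \<in> extensional {..<n}"
      using F.finsum_closed[OF mem] by (auto simp: PiE_iff)
    fix k assume "k \<in> {..<n}"
    then have k: "k < n" by simp
    have "(\<Oplus>\<^bsub>free_module R n\<^esub>i\<in>{..<n}. a i \<odot>\<^bsub>free_module R n\<^esub> unit_vec n i) k
        = (\<Oplus>i\<in>{..<n}. (a i \<odot>\<^bsub>free_module R n\<^esub> unit_vec n i) k)"
      by (rule finsum_free_module_apply[OF _ mem k]) simp
    also have "\<dots> = (\<Oplus>i\<in>{..<n}. if k = i then a i else \<zero>)"
      using k ai by (intro finsum_cong') (auto simp: unit_vec_def)
    also have "\<dots> = a k"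
      using k ai by (intro finsum_singleton) auto
    finally show "a k = (\<Oplus>\<^bsub>free_module R n\<^esub>i\<in>{..<n}. a i \<odot>\<^bsub>free_module R n\<^esub> unit_vec n i) k" by simp
  qed
qed

lemma free_hom_expand:
  assumes N: "module R N" and f: "f \<in> mod_hom R (free_module R n) N"
    and a: "a \<in> carrier (free_module R n)"
  shows "f a = (\<Oplus>\<^bsub>N\<^esub>i\<in>{..<n}. a i \<odot>\<^bsub>N\<^esub> f (unit_vec n i))"
proof -
  interpret N: module R N by fact
  interpret F: module R "free_module R n" by (rule free_module_module)
  have ai: "a i \<in> carrier R" if "i < n" for i using a that by (auto simp: PiE_iff)
  have mem: "(\<lambda>i. a i \<odot>\<^bsub>free_module R n\<^esub> unit_vec n i) \<in> {..<n} \<rightarrow> carrier (free_module R n)"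
    using ai by (intro Pi_I F.smult_closed) auto
  have "f a = f (\<Oplus>\<^bsub>free_module R n\<^esub>i\<in>{..<n}. a i \<odot>\<^bsub>free_module R n\<^esub> unit_vec n i)"
    using free_module_expand[OF a] by simp
  also have "\<dots> = (\<Oplus>\<^bsub>N\<^esub>i\<in>{..<n}. f (a i \<odot>\<^bsub>free_module R n\<^esub> unit_vec n i))"
    by (rule mod_hom_finsum[OF free_module_module N f _ mem]) simp
  also have "\<dots> = (\<Oplus>\<^bsub>N\<^esub>i\<in>{..<n}. a i \<odot>\<^bsub>N\<^esub> f (unit_vec n i))"
    using ai mod_hom_closed[OF f]
    by (intro N.finsum_cong') (auto simp del: free_module_simps(4) simp: mod_hom_smult[OF f])
  finally show ?thesis .
qed

lemma free_hom_exists: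
  assumes N: "module R N" and x: "\<And>i. i < n \<Longrightarrow> x i \<in> carrier N"
  shows "\<exists>f\<in>mod_hom R (free_module R n) N.
    (\<forall>a\<in>carrier (free_module R n). f a = (\<Oplus>\<^bsub>N\<^esub>i\<in>{..<n}. a i \<odot>\<^bsub>N\<^esub> x i)) \<and>
    (\<forall>i<n. f (unit_vec n i) = x i)"
proof -
  interpret N: module R N by fact
  interpret F: module R "free_module R n" by (rule free_module_module)
  define f where "f = (\<lambda>a\<in>carrier (free_module R n). \<Oplus>\<^bsub>N\<^esub>i\<in>{..<n}. a i \<odot>\<^bsub>N\<^esub> x i)"
  have fa: "f a = (\<Oplus>\<^bsub>N\<^esub>i\<in>{..<n}. a i \<odot>\<^bsub>N\<^esub> x i)" if "a \<in> carrier (free_module R n)" for a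
    using that by (simp add: f_def)
  have cl: "a i \<in> carrier R" if "a \<in> carrier (free_module R n)" "i < n" for a i
    using that by (auto simp: PiE_iff)
  have "f \<in> mod_hom R (free_module R n) N"
  proof (rule mod_homI)
    show "f \<in> extensional (carrier (free_module R n))" by (simp add: f_def)
  next
    fix a assume a: "a \<in> carrier (free_module R n)"
    then show "f a \<in> carrier N" using x cl by (auto simp: fa simp del: free_module_simps(1))
    fix b assume b: "b \<in> carrier (free_module R n)"
    have "f (a \<oplus>\<^bsub>free_module R n\<^esub> b)
        = (\<Oplus>\<^bsub>N\<^esub>i\<in>{..<n}. (a \<oplus>\<^bsub>free_module R n\<^esub> b) i \<odot>\<^bsub>N\<^esub> x i)"
      by (rule fa[OF F.a_closed[OF a b]])
    also have "\<dots> = (\<Oplus>\<^bsub>N\<^esub>i\<in>{..<n}. a i \<odot>\<^bsub>N\<^esub> x i \<oplus>\<^bsub>N\<^esub> b i \<odot>\<^bsub>N\<^esub> x i)"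
      using x cl[OF a] cl[OF b] by (intro N.finsum_cong') (auto simp: N.smult_l_distr)
    also have "\<dots> = f a \<oplus>\<^bsub>N\<^esub> f b"
      using x cl[OF a] cl[OF b] by (simp add: fa[OF a] fa[OF b] N.finsum_addf Pi_iff)
    finally show "f (a \<oplus>\<^bsub>free_module R n\<^esub> b) = f a \<oplus>\<^bsub>N\<^esub> f b" .
  next
    fix c a assume c: "c \<in> carrier R" and a: "a \<in> carrier (free_module R n)"
    have "f (c \<odot>\<^bsub>free_module R n\<^esub> a) = (\<Oplus>\<^bsub>N\<^esub>i\<in>{..<n}. (c \<odot>\<^bsub>free_module R n\<^esub> a) i \<odot>\<^bsub>N\<^esub> x i)"
      by (rule fa[OF F.smult_closed[OF c a]])
    also have "\<dots> = (\<Oplus>\<^bsub>N\<^esub>i\<in>{..<n}. c \<odot>\<^bsub>N\<^esub> (a i \<odot>\<^bsub>N\<^esub> x i))"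
      using x cl[OF a] c by (intro N.finsum_cong') (auto simp: N.smult_assoc1)
    also have "\<dots> = c \<odot>\<^bsub>N\<^esub> f a"
      using x cl[OF a] c by (simp add: fa[OF a] N.finsum_smult_ldistr Pi_iff)
    finally show "f (c \<odot>\<^bsub>free_module R n\<^esub> a) = c \<odot>\<^bsub>N\<^esub> f a" .
  qed
  moreover have "f (unit_vec n j) = x j" if j: "j < n" for j
  proof -
    have "f (unit_vec n j) = (\<Oplus>\<^bsub>N\<^esub>i\<in>{..<n}. unit_vec n j i \<odot>\<^bsub>N\<^esub> x i)"
      by (rule fa) simp
    also have "\<dots> = (\<Oplus>\<^bsub>N\<^esub>i\<in>{..<n}. if j = i then x i else \<zero>\<^bsub>N\<^esub>)"
      using x by (intro N.finsum_cong') (auto simp: unit_vec_def)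
    also have "\<dots> = x j" using j x by (intro N.finsum_singleton) auto
    finally show ?thesis .
  qed
  ultimately show ?thesis using fa by blast
qed

lemma free_hom_lift:
  assumes M: "module R M" and N: "module R N" and p: "p \<in> mod_hom R M N"
    and surj: "p ` carrier M = carrier N" and f: "f \<in> mod_hom R (free_module R n) N"
  shows "\<exists>g\<in>mod_hom R (free_module R n) M. \<forall>a\<in>carrier (free_module R n). p (g a) = f a"
proof -
  interpret N: module R N by fact
  interpret M: module R M by fact
  have "\<exists>y\<in>carrier M. p y = f (unit_vec n i)" for i
    using mod_hom_closed[OF f, of "unit_vec n i"] surj by (auto simp: image_iff set_eq_iff) metis
  then obtain y where y: "\<And>i. y i \<in> carrier M" "\<And>i. p (y i) = f (unit_vec n i)" by metis
  obtain g where g: "g \<in> mod_hom R (free_module R n) M" and gy: "\<forall>i<n. g (unit_vec n i) = y i"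
    using free_hom_exists[OF M, of n y] y(1) by blast
  have "p (g a) = f a" if a: "a \<in> carrier (free_module R n)" for a
  proof -
    have ai: "a i \<in> carrier R" if "i < n" for i using a that by (auto simp: PiE_iff)
    have "p (g a) = compose (carrier (free_module R n)) p g a" using a by (simp add: compose_def)
    also have "\<dots> = (\<Oplus>\<^bsub>N\<^esub>i\<in>{..<n}. a i \<odot>\<^bsub>N\<^esub> compose (carrier (free_module R n)) p g (unit_vec n i))"
      by (rule free_hom_expand[OF N mod_hom_compose[OF free_module_module g p] a])
    also have "\<dots> = (\<Oplus>\<^bsub>N\<^esub>i\<in>{..<n}. a i \<odot>\<^bsub>N\<^esub> f (unit_vec n i))"
      using ai mod_hom_closed[OF f] by (intro N.finsum_cong') (auto simp: compose_def gy y(2))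
    also have "\<dots> = f a" by (rule free_hom_expand[OF N f a, symmetric])
    finally show ?thesis .
  qed
  with g show ?thesis by blast
qed

text \<open>A map into a free module is a tuple of functionals.\<close>

lemma mod_hom_free_tuple:
  assumes M: "module R M" and g: "\<And>i. i < n \<Longrightarrow> g i \<in> mod_hom R M (self_module R)"
  shows "(\<lambda>x\<in>carrier M. \<lambda>i\<in>{..<n}. g i x) \<in> mod_hom R M (free_module R n)"
proof -
  interpret M: module R M by fact
  show ?thesis
  proof (rule mod_homI)
    show "(\<lambda>x\<in>carrier M. \<lambda>i\<in>{..<n}. g i x) x \<in> carrier (free_module R n)" if "x \<in> carrier M" for x
      using that mod_hom_closed[OF g, of _ x] by auto
  qed (auto simp: mod_hom_add[OF g] mod_hom_smult[OF g] intro!: restrict_ext)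
qed

end

section \<open>Generating sets and minimal free covers\<close>

text \<open>
  Stated with submodules instead of linear combinations: to see that a set generates, it then
  suffices to follow its elements through closure properties.
\<close>

definition generates :: "'a ring \<Rightarrow> ('a, 'b) module \<Rightarrow> 'b set \<Rightarrow> bool" where
  "generates R M S \<longleftrightarrow> S \<subseteq> carrier M \<and> (\<forall>H. submodule H R M \<longrightarrow> S \<subseteq> H \<longrightarrow> carrier M \<subseteq> H)"

lemma submodule_zero_closed:
  assumes "submodule H R M"
  shows "\<zero>\<^bsub>M\<^esub> \<in> H"
  using subgroup.one_closed[OF submodule.axioms(1)[OF assms]] by simp

lemma (in module) submoduleI_smult:
  assumes "H \<subseteq> carrier M" "\<zero>\<^bsub>M\<^esub> \<in> H"
    and "\<And>a b. a \<in> H \<Longrightarrow> b \<in> H \<Longrightarrow> a \<oplus>\<^bsub>M\<^esub> b \<in> H"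
    and smult: "\<And>a x. a \<in> carrier R \<Longrightarrow> x \<in> H \<Longrightarrow> a \<odot>\<^bsub>M\<^esub> x \<in> H"
  shows "submodule H R M"
proof (rule submoduleI)
  fix x assume x: "x \<in> H"
  then have "x \<in> carrier M" using assms(1) by auto
  then have "\<ominus>\<^bsub>M\<^esub> x = (\<ominus> \<one>) \<odot>\<^bsub>M\<^esub> x" by (simp add: smult_l_minus)
  then show "\<ominus>\<^bsub>M\<^esub> x \<in> H" using smult[of "\<ominus> \<one>" x] x by simp
qed (use assms in auto)

lemma submodule_of_submodule:
  assumes M: "module R M" and K: "submodule K R M" and H: "submodule H R (M\<lparr>carrier := K\<rparr>)"
  shows "submodule H R M"
proof -
  interpret M: module R M by fact
  interpret K: module R "M\<lparr>carrier := K\<rparr>" by (rule submodule.submodule_is_module[OF K M])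
  show ?thesis
    using K.submoduleE[OF H] M.submoduleE(1)[OF K] submodule_zero_closed[OF H]
    by (intro M.submoduleI_smult) auto
qed

lemma (in module) submodule_finsum_closed:
  assumes H: "submodule H R M" and "finite A" "x \<in> A \<rightarrow> H"
  shows "(\<Oplus>\<^bsub>M\<^esub>i\<in>A. x i) \<in> H"
  using assms(2,3)
proof (induction A)
  case empty
  then show ?case using submodule_zero_closed[OF H] by simp
next
  case (insert a A)
  have "x \<in> A \<rightarrow> carrier M" "x a \<in> carrier M" using insert.prems submoduleE(1)[OF H] by auto
  then show ?case using insert submoduleE(5)[OF H] by (simp add: Pi_iff)
qed

context base_ring
begin

lemma surj_of_generates:
  assumes M: "module R M" and f: "f \<in> mod_hom R (free_module R n) M"
    and gen: "generates R M ((\<lambda>i. f (unit_vec n i)) ` {..<n})"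
  shows "f ` carrier (free_module R n) = carrier M"
proof
  interpret F: module R "free_module R n" by (rule free_module_module)
  show "f ` carrier (free_module R n) \<subseteq> carrier M" using mod_hom_closed[OF f] by blast
  have "submodule (f ` carrier (free_module R n)) R M"
    by (rule image_submodule[OF free_module_module M f F.carrier_is_submodule])
  moreover have "(\<lambda>i. f (unit_vec n i)) ` {..<n} \<subseteq> f ` carrier (free_module R n)" by auto
  ultimately show "carrier M \<subseteq> f ` carrier (free_module R n)"
    using gen by (auto simp: generates_def)
qed

lemma fg_module_iff_generates:
  "fg_module R M \<longleftrightarrow> module R M \<and> (\<exists>S. finite S \<and> generates R M S)"
proof
  assume fg: "fg_module R M"
  then obtain S where M: "module R M" and S: "finite S" "S \<subseteq> carrier M"
    and comb: "\<forall>x \<in> carrier M. \<exists>c \<in> S \<rightarrow> carrier R. x = (\<Oplus>\<^bsub>M\<^esub>s\<in>S. c s \<odot>\<^bsub>M\<^esub> s)"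
    unfolding fg_module_def by blast
  interpret M: module R M by fact
  have "x \<in> H" if H: "submodule H R M" "S \<subseteq> H" and x: "x \<in> carrier M" for H x
  proof -
    obtain c where c: "c \<in> S \<rightarrow> carrier R" "x = (\<Oplus>\<^bsub>M\<^esub>s\<in>S. c s \<odot>\<^bsub>M\<^esub> s)" using comb x by blast
    show ?thesis
      unfolding c(2) using c(1) H
      by (intro M.submodule_finsum_closed[OF H(1) S(1)]) (auto intro!: M.submoduleE(4)[OF H(1)])
  qed
  then show "module R M \<and> (\<exists>S. finite S \<and> generates R M S)"
    using M S by (auto simp: generates_def)
next
  assume "module R M \<and> (\<exists>S. finite S \<and> generates R M S)"
  then obtain S where M: "module R M" and fin: "finite S" and gen: "generates R M S" by blast
  interpret M: module R M by fact
  have SM: "S \<subseteq> carrier M" using gen by (simp add: generates_def)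
  obtain x where x: "bij_betw x {..<card S} S"
    using ex_bij_betw_nat_finite[OF fin] by (auto simp: atLeast0LessThan)
  let ?n = "card S"
  have xM: "x i \<in> carrier M" if "i < ?n" for i using x SM that by (auto simp: bij_betw_def)
  obtain f where f: "f \<in> mod_hom R (free_module R ?n) M"
    and fa: "\<And>a. a \<in> carrier (free_module R ?n) \<Longrightarrow> f a = (\<Oplus>\<^bsub>M\<^esub>i\<in>{..<?n}. a i \<odot>\<^bsub>M\<^esub> x i)"
    and fx: "\<And>i. i < ?n \<Longrightarrow> f (unit_vec ?n i) = x i"
    using free_hom_exists[OF M, of ?n x] xM by blast
  have "(\<lambda>i. f (unit_vec ?n i)) ` {..<?n} = S"
    using x fx by (auto simp: bij_betw_def image_iff set_eq_iff)
  then have surj: "f ` carrier (free_module R ?n) = carrier M"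
    using surj_of_generates[OF M f] gen by simp
  have "\<exists>c \<in> S \<rightarrow> carrier R. y = (\<Oplus>\<^bsub>M\<^esub>s\<in>S. c s \<odot>\<^bsub>M\<^esub> s)" if y: "y \<in> carrier M" for y
  proof -
    obtain a where a: "a \<in> carrier (free_module R ?n)" "y = f a" using y surj by auto
    define c where "c s = a (inv_into {..<?n} x s)" for s
    have aR: "a i \<in> carrier R" if "i < ?n" for i using a(1) that by (auto simp: PiE_iff)
    have inv: "inv_into {..<?n} x (x i) = i" if "i < ?n" for i
      using x that by (simp add: bij_betw_def)
    have cS: "c \<in> S \<rightarrow> carrier R"
    proof
      fix s assume "s \<in> S"
      then obtain i where "i < ?n" "s = x i" using x by (auto simp: bij_betw_def)
      then show "c s \<in> carrier R" using inv aR by (simp add: c_def)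
    qed
    have "(\<Oplus>\<^bsub>M\<^esub>s\<in>S. c s \<odot>\<^bsub>M\<^esub> s) = (\<Oplus>\<^bsub>M\<^esub>s\<in>x ` {..<?n}. c s \<odot>\<^bsub>M\<^esub> s)"
      using x by (simp add: bij_betw_def)
    also have "\<dots> = (\<Oplus>\<^bsub>M\<^esub>i\<in>{..<?n}. c (x i) \<odot>\<^bsub>M\<^esub> x i)"
      using x cS SM by (intro M.finsum_reindex) (auto simp: bij_betw_def Pi_iff)
    also have "\<dots> = (\<Oplus>\<^bsub>M\<^esub>i\<in>{..<?n}. a i \<odot>\<^bsub>M\<^esub> x i)"
      using aR xM inv by (intro M.finsum_cong') (auto simp: c_def)
    also have "\<dots> = y" using fa a by simp
    finally show ?thesis using cS by auto
  qed
  then show "fg_module R M" unfolding fg_module_def using M fin SM by blast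
qed

lemma self_submodule_ideal:
  assumes "submodule I R (self_module R)"
  shows "ideal I R"
proof (rule idealI)
  interpret S: module R "self_module R" by (rule self_module_module)
  note I = S.submoduleE[OF assms]
  show "subgroup I (add_monoid R)"
  proof (rule add.subgroupI)
    fix x assume x: "x \<in> I"
    then have "(\<ominus> \<one>) \<otimes> x \<in> I" using I(4)[of "\<ominus> \<one>" x] by simp
    then show "\<ominus> x \<in> I" using x I(1) by (simp add: l_minus subset_iff)
  next
    fix x y assume "x \<in> I" "y \<in> I"
    then show "x \<oplus> y \<in> I" using I(5)[of x y] by simp
  qed (use I(1,2) in auto)
  fix a x assume "a \<in> I" "x \<in> carrier R"
  then show "x \<otimes> a \<in> I" "a \<otimes> x \<in> I" using I(1) I(4)[of x a] m_comm[of x a] by auto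
qed (rule ring_axioms)

end

locale local_base = noetherian_local_ring R for R :: "'a ring" (structure)

sublocale local_base \<subseteq> base_ring R
  by unfold_locales

context local_base
begin

abbreviation \<mm> :: "'a set" where "\<mm> \<equiv> maximal_ideal R"

lemma maximalideal_maximal_ideal: "maximalideal \<mm> R"
  unfolding maximal_ideal_def by (rule theI'[OF unique_maximalideal])

lemma maximal_ideal_subset: "\<mm> \<subseteq> carrier R"
  using maximalideal_maximal_ideal
  by (meson additive_subgroup.a_subset ideal.axioms(1) maximalideal_def)

lemma ideal_maximal_ideal: "ideal \<mm> R"
  using maximalideal_maximal_ideal by (simp add: maximalideal_def)

lemma one_notin_maximal_ideal: "\<one> \<notin> \<mm>"
  using maximalideal.I_notcarr[OF maximalideal_maximal_ideal]
    ideal.one_imp_carrier[OF ideal_maximal_ideal] by auto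

text \<open>
  A non-unit lies in an ideal that is maximal among the proper ones containing it, hence in the
  only maximal ideal.
\<close>

lemma unit_if_notin_maximal_ideal:
  assumes a: "a \<in> carrier R" and nm: "a \<notin> \<mm>"
  shows "a \<in> Units R"
proof (rule ccontr)
  assume nu: "a \<notin> Units R"
  define \<C> where "\<C> = {I. ideal I R \<and> a \<in> I \<and> \<one> \<notin> I}"
  have "PIdl a \<in> \<C>"
    using a nu cgenideal_ideal cgenideal_self m_comm
    by (auto simp: \<C>_def cgenideal_def Units_def)
  then have "\<C> \<noteq> {}" by auto
  moreover have "\<Union>C \<in> \<C>" if C: "C \<noteq> {}" "subset.chain \<C> C" for C
  proof -
    have "subset.chain {I. ideal I R} C" using C(2) by (auto simp: subset_chain_def \<C>_def)
    then have "\<Union>C \<in> C" using ideal_chain_is_trivial[OF C(1)] by simp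
    then show ?thesis using C(2) by (auto simp: subset_chain_def)
  qed
  ultimately obtain I where I: "I \<in> \<C>" and max: "\<And>J. J \<in> \<C> \<Longrightarrow> I \<subseteq> J \<Longrightarrow> J = I"
    using subset_Zorn_nonempty[of \<C>] by metis
  have "maximalideal I R"
  proof (rule maximalidealI)
    show "ideal I R" using I by (simp add: \<C>_def)
    show "carrier R \<noteq> I" using I by (auto simp: \<C>_def)
    fix J assume J: "ideal J R" "I \<subseteq> J" "J \<subseteq> carrier R"
    show "J = I \<or> J = carrier R"
    proof (cases "\<one> \<in> J")
      case True
      then show ?thesis using ideal.one_imp_carrier[OF J(1)] by simp
    next
      case False
      then have "J \<in> \<C>" using J I by (auto simp: \<C>_def)
      then show ?thesis using max J(2) by simp
    qed
  qed
  then have "I = \<mm>" using maximalideal_maximal_ideal unique_maximalideal by blast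
  then show False using I nm by (simp add: \<C>_def)
qed

lemma free_hom_maximal_ideal:
  assumes f: "f \<in> mod_hom R (free_module R n) (free_module R k)"
    and a: "a \<in> {..<n} \<rightarrow>\<^sub>E \<mm>"
  shows "f a \<in> {..<k} \<rightarrow>\<^sub>E \<mm>"
proof -
  interpret F: module R "free_module R k" by (rule free_module_module)
  interpret I: ideal \<mm> R by (rule ideal_maximal_ideal)
  have aF: "a \<in> carrier (free_module R n)" using a maximal_ideal_subset by (auto simp: PiE_iff)
  have H: "submodule ({..<k} \<rightarrow>\<^sub>E \<mm>) R (free_module R k)"
    using maximal_ideal_subset by (intro F.submoduleI_smult) (auto simp: PiE_iff I.I_l_closed)
  have "a i \<odot>\<^bsub>free_module R k\<^esub> f (unit_vec n i) \<in> {..<k} \<rightarrow>\<^sub>E \<mm>" if "i < n" for i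
  proof -
    have "f (unit_vec n i) \<in> {..<k} \<rightarrow>\<^sub>E carrier R" using mod_hom_closed[OF f, of "unit_vec n i"] by simp
    then show ?thesis using a that by (auto simp: PiE_iff I.I_r_closed)
  qed
  then show ?thesis
    unfolding free_hom_expand[OF free_module_module f aF]
    by (intro F.submodule_finsum_closed[OF H]) auto
qed

text \<open>
  A generating set of least cardinality gives a minimal cover: a relation with a coefficient
  outside of the maximal ideal, that is, with a unit as a coefficient, would make one generator
  superfluous.
\<close>

lemma minimal_free_cover_exists:
  assumes "fg_module R M"
  shows "\<exists>n p. minimal_free_cover R M n p"
proof -
  have M: "module R M" using assms by (simp add: fg_module_def)
  interpret M: module R M by fact
  define P where "P n \<longleftrightarrow> (\<exists>S. finite S \<and> card S = n \<and> generates R M S)" for n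
  define n where "n = (LEAST n. P n)"
  have "\<exists>n. P n" using assms by (auto simp: fg_module_iff_generates P_def)
  then have "P n" unfolding n_def by (rule LeastI_ex)
  then obtain S where fin: "finite S" and cS: "card S = n" and gen: "generates R M S"
    by (auto simp: P_def)
  have SM: "S \<subseteq> carrier M" using gen by (simp add: generates_def)
  obtain x where x: "bij_betw x {..<n} S"
    using ex_bij_betw_nat_finite[OF fin] cS by (auto simp: atLeast0LessThan)
  have xM: "x i \<in> carrier M" if "i < n" for i using x SM that by (auto simp: bij_betw_def)
  obtain f where f: "f \<in> mod_hom R (free_module R n) M"
    and fa: "\<And>a. a \<in> carrier (free_module R n) \<Longrightarrow> f a = (\<Oplus>\<^bsub>M\<^esub>i\<in>{..<n}. a i \<odot>\<^bsub>M\<^esub> x i)"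
    and fx: "\<And>i. i < n \<Longrightarrow> f (unit_vec n i) = x i"
    using free_hom_exists[OF M, of n x] xM by blast
  have "(\<lambda>i. f (unit_vec n i)) ` {..<n} = S"
    using x fx by (auto simp: bij_betw_def image_iff set_eq_iff)
  then have surj: "f ` carrier (free_module R n) = carrier M"
    using surj_of_generates[OF M f] gen by simp
  have "a j \<in> \<mm>" if a: "a \<in> carrier (free_module R n)" "f a = \<zero>\<^bsub>M\<^esub>" and j: "j < n" for a j
  proof (rule ccontr)
    assume nm: "a j \<notin> \<mm>"
    have aR: "a i \<in> carrier R" if "i < n" for i using a(1) that by (auto simp: PiE_iff)
    have u: "a j \<in> Units R" using unit_if_notin_maximal_ideal[OF aR[OF j] nm] .
    have "generates R M (S - {x j})"
      unfolding generates_def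
    proof (intro conjI allI impI)
      show "S - {x j} \<subseteq> carrier M" using SM by auto
      fix H assume H: "submodule H R M" and SH: "S - {x j} \<subseteq> H"
      have xH: "x i \<in> H" if "i \<in> {..<n} - {j}" for i
        using that x SH j by (auto simp: bij_betw_def inj_on_def)
      define r where "r = (\<Oplus>\<^bsub>M\<^esub>i\<in>{..<n} - {j}. a i \<odot>\<^bsub>M\<^esub> x i)"
      have rH: "r \<in> H"
        unfolding r_def using xH aR
        by (intro M.submodule_finsum_closed[OF H]) (auto intro!: M.submoduleE(4)[OF H])
      have rM: "r \<in> carrier M" using rH M.submoduleE(1)[OF H] by auto
      have "\<zero>\<^bsub>M\<^esub> = (\<Oplus>\<^bsub>M\<^esub>i\<in>insert j ({..<n} - {j}). a i \<odot>\<^bsub>M\<^esub> x i)"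
        using fa[OF a(1)] a(2) j by (simp add: insert_absorb)
      also have "\<dots> = a j \<odot>\<^bsub>M\<^esub> x j \<oplus>\<^bsub>M\<^esub> r"
        unfolding r_def using aR xM j by (intro M.finsum_insert) auto
      finally have "a j \<odot>\<^bsub>M\<^esub> x j = \<ominus>\<^bsub>M\<^esub> r"
        using rM aR xM j by (intro M.minus_equality[symmetric]) auto
      then have ajH: "a j \<odot>\<^bsub>M\<^esub> x j \<in> H" using M.submoduleE(3)[OF H rH] by simp
      have "x j = inv (a j) \<odot>\<^bsub>M\<^esub> (a j \<odot>\<^bsub>M\<^esub> x j)"
        using u aR[OF j] xM[OF j] by (simp flip: M.smult_assoc1)
      then have "x j \<in> H" using M.submoduleE(4)[OF H _ ajH] u by (metis Units_inv_closed)
      then have "S \<subseteq> H" using SH by auto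
      then show "carrier M \<subseteq> H" using gen H by (auto simp: generates_def)
    qed
    moreover have "x j \<in> S" using x j by (auto simp: bij_betw_def)
    ultimately have "P (n - 1)" unfolding P_def using fin cS by (intro exI[of _ "S - {x j}"]) auto
    then have "n \<le> n - 1" unfolding n_def by (rule Least_le)
    then show False using j by simp
  qed
  then have "a_kernel (free_module R n) M f \<subseteq> {..<n} \<rightarrow>\<^sub>E \<mm>"
    by (auto simp: a_kernel_def' PiE_iff dest: extensional_arb)
  then show ?thesis using f surj by (auto simp: minimal_free_cover_def)
qed

lemma cover_minimal_free_cover:
  assumes "fg_module R M"
  shows "minimal_free_cover R M (fst (cover R M)) (snd (cover R M))"
  unfolding cover_def
  by (rule someI_ex) (use minimal_free_cover_exists[OF assms] in auto)

text \<open>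
  Hilbert's argument, by induction on the number of coordinates that may be nonzero: the last ones
  of these form an ideal, and lifts of its generators together with generators of the part where
  that coordinate vanishes generate everything.
\<close>

lemma submodule_free_finitely_generated:
  assumes "submodule K R (free_module R N)" "n \<le> N"
    and "\<And>x i. x \<in> K \<Longrightarrow> n \<le> i \<Longrightarrow> i < N \<Longrightarrow> x i = \<zero>"
  shows "\<exists>S. finite S \<and> S \<subseteq> K \<and> (\<forall>H. submodule H R (free_module R N) \<longrightarrow> S \<subseteq> H \<longrightarrow> K \<subseteq> H)"
  using assms
proof (induction n arbitrary: K)
  case 0
  interpret F: module R "free_module R N" by (rule free_module_module)
  have "x = \<zero>\<^bsub>free_module R N\<^esub>" if "x \<in> K" for x
    using that 0(3)[OF that] F.submoduleE(1)[OF 0(1)]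
    by (auto simp: PiE_iff extensional_def fun_eq_iff)
  then show ?case by (intro exI[of _ "{}"]) (auto dest: submodule_zero_closed)
next
  case (Suc n)
  let ?F = "free_module R N"
  interpret F: module R ?F by (rule free_module_module)
  note K = F.submoduleE[OF Suc.prems(1)]
  have n: "n < N" using Suc.prems(2) by simp
  have leading_ideal: "ideal ((\<lambda>x. x n) ` L) R" if L: "submodule L R ?F" for L
  proof -
    have "(\<lambda>x\<in>carrier ?F. x n) ` L = (\<lambda>x. x n) ` L"
      using F.submoduleE(1)[OF L] by (intro image_cong) auto
    then show ?thesis
      using image_submodule[OF free_module_module self_module_module coordinate_mod_hom[OF n] L]
      by (intro self_submodule_ideal) simp
  qed
  obtain A where A: "A \<subseteq> carrier R" "finite A" "(\<lambda>x. x n) ` K = Idl A"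
    using finetely_gen[OF leading_ideal[OF Suc.prems(1)]] by blast
  have "A \<subseteq> (\<lambda>x. x n) ` K" using genideal_self[OF A(1)] A(3) by simp
  then have "\<forall>a\<in>A. \<exists>x. x \<in> K \<and> x n = a" by auto
  then obtain k where "\<forall>a\<in>A. k a \<in> K \<and> k a n = a" by (rule bchoice[THEN exE])
  then have k: "\<And>a. a \<in> A \<Longrightarrow> k a \<in> K" "\<And>a. a \<in> A \<Longrightarrow> k a n = a" by auto
  define K' where "K' = {x \<in> K. x n = \<zero>}"
  have K': "submodule K' R ?F"
  proof (rule F.submoduleI_smult)
    show "K' \<subseteq> carrier ?F" using K(1) by (auto simp: K'_def)
    show "\<zero>\<^bsub>?F\<^esub> \<in> K'" using submodule_zero_closed[OF Suc.prems(1)] n by (simp add: K'_def)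
    show "x \<oplus>\<^bsub>?F\<^esub> y \<in> K'" if "x \<in> K'" "y \<in> K'" for x y
      using that K(5)[of x y] n by (simp add: K'_def)
    show "a \<odot>\<^bsub>?F\<^esub> x \<in> K'" if "a \<in> carrier R" "x \<in> K'" for a x
      using that K(4)[of a x] n by (simp add: K'_def)
  qed
  have "x i = \<zero>" if "x \<in> K'" "n \<le> i" "i < N" for x i
    using that Suc.prems(3)[of x i] by (cases "i = n") (auto simp: K'_def)
  then obtain S where S: "finite S" "S \<subseteq> K'"
    and SH: "\<And>H. submodule H R ?F \<Longrightarrow> S \<subseteq> H \<Longrightarrow> K' \<subseteq> H"
    using Suc.IH[OF K'] n by (metis less_imp_le_nat)
  have "K \<subseteq> H" if H: "submodule H R ?F" "S \<union> k ` A \<subseteq> H" for H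
  proof
    fix x assume x: "x \<in> K"
    note HE = F.submoduleE[OF H(1)]
    have HK: "submodule (H \<inter> K) R ?F"
      using K(1,4,5) HE(4,5) submodule_zero_closed[OF Suc.prems(1)] submodule_zero_closed[OF H(1)]
      by (intro F.submoduleI_smult) (simp_all add: le_infI2)
    have "A \<subseteq> (\<lambda>x. x n) ` (H \<inter> K)"
    proof
      fix a assume a: "a \<in> A"
      then have "k a \<in> H \<inter> K" using k(1) H(2) by auto
      then show "a \<in> (\<lambda>x. x n) ` (H \<inter> K)" using k(2)[OF a] by (metis imageI)
    qed
    then have "Idl A \<subseteq> (\<lambda>x. x n) ` (H \<inter> K)" by (rule genideal_minimal[OF leading_ideal[OF HK]])
    then have "(\<lambda>x. x n) ` K \<subseteq> (\<lambda>x. x n) ` (H \<inter> K)" using A(3) by simp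
    then have "x n \<in> (\<lambda>x. x n) ` (H \<inter> K)" using x by (rule image_subset_iff[THEN iffD1, THEN bspec])
    then obtain y where y: "y \<in> H" "y \<in> K" "y n = x n" by (auto elim!: imageE)
    have xy: "x \<in> carrier ?F" "y \<in> carrier ?F" using x y K(1) by auto
    have mem: "x \<ominus>\<^bsub>?F\<^esub> y \<in> K" unfolding a_minus_def using x y K by simp
    have "(x \<ominus>\<^bsub>?F\<^esub> y) \<oplus>\<^bsub>?F\<^esub> y = x" using xy by (simp add: F.minus_add F.a_assoc F.l_neg a_minus_def del: free_module_simps)
    then have xeq: "x = (x \<ominus>\<^bsub>?F\<^esub> y) \<oplus>\<^bsub>?F\<^esub> y" by simp
    have "(x \<ominus>\<^bsub>?F\<^esub> y) n \<in> carrier R" using mem K(1) n by (auto simp: PiE_iff)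
    moreover have "x n \<in> carrier R" using xy n by (auto simp: PiE_iff)
    moreover have "(x \<ominus>\<^bsub>?F\<^esub> y) n \<oplus> x n = x n" using fun_cong[OF xeq, of n] n y(3) by simp
    ultimately have "(x \<ominus>\<^bsub>?F\<^esub> y) n = \<zero>" by (metis add.r_cancel_one)
    then have "x \<ominus>\<^bsub>?F\<^esub> y \<in> H" using SH[OF H(1)] H(2) mem by (auto simp: K'_def)
    then show "x \<in> H" using HE(5) y(1) xeq by metis
  qed
  moreover have "S \<union> k ` A \<subseteq> K" using S(2) k(1) by (auto simp: K'_def)
  ultimately show ?case using S(1) A(2) by (intro exI[of _ "S \<union> k ` A"]) auto
qed

lemma submodule_free_fg_module:
  assumes K: "submodule K R (free_module R n)"
  shows "fg_module R ((free_module R n)\<lparr>carrier := K\<rparr>)"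
proof -
  obtain S where "finite S" "S \<subseteq> K"
    "\<And>H. submodule H R (free_module R n) \<Longrightarrow> S \<subseteq> H \<Longrightarrow> K \<subseteq> H"
    using submodule_free_finitely_generated[OF K order_refl] by auto
  then have "generates R ((free_module R n)\<lparr>carrier := K\<rparr>) S"
    using submodule_of_submodule[OF free_module_module K] by (simp add: generates_def)
  with \<open>finite S\<close> show ?thesis
    using submodule.submodule_is_module[OF K free_module_module]
    unfolding fg_module_iff_generates by blast
qed

end

section \<open>The minimal free resolution and vanishing of Ext\<close>

lemma hom_module_simps [simp]:
  "carrier (hom_module R M N) = mod_hom R M N"
  "\<zero>\<^bsub>hom_module R M N\<^esub> = (\<lambda>x\<in>carrier M. \<zero>\<^bsub>N\<^esub>)"
  "f \<oplus>\<^bsub>hom_module R M N\<^esub> g = (\<lambda>x\<in>carrier M. f x \<oplus>\<^bsub>N\<^esub> g x)"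
  by (simp_all add: hom_module_def)

lemma hom_module_abelian_group:
  assumes M: "module R M" and N: "module R N"
  shows "abelian_group (hom_module R M N)"
proof -
  interpret M: module R M by fact
  interpret N: module R N by fact
  have zero: "(\<lambda>x\<in>carrier M. \<zero>\<^bsub>N\<^esub>) \<in> mod_hom R M N"
    by (rule mod_homI) simp_all
  have add: "(\<lambda>x\<in>carrier M. f x \<oplus>\<^bsub>N\<^esub> g x) \<in> mod_hom R M N"
    if f: "f \<in> mod_hom R M N" and g: "g \<in> mod_hom R M N" for f g
  proof (rule mod_homI)
    fix x y assume "x \<in> carrier M" "y \<in> carrier M"
    moreover from this have "f x \<in> carrier N" "f y \<in> carrier N" "g x \<in> carrier N" "g y \<in> carrier N"
      using mod_hom_closed[OF f] mod_hom_closed[OF g] by auto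
    ultimately show "(\<lambda>x\<in>carrier M. f x \<oplus>\<^bsub>N\<^esub> g x) (x \<oplus>\<^bsub>M\<^esub> y) =
        (\<lambda>x\<in>carrier M. f x \<oplus>\<^bsub>N\<^esub> g x) x \<oplus>\<^bsub>N\<^esub> (\<lambda>x\<in>carrier M. f x \<oplus>\<^bsub>N\<^esub> g x) y"
      by (simp add: mod_hom_add[OF f] mod_hom_add[OF g] N.a_ac)
  qed (simp_all add: mod_homD(1,4)[OF f] mod_homD(1,4)[OF g] N.smult_r_distr)
  show ?thesis
  proof (rule abelian_groupI)
    fix f g assume f: "f \<in> carrier (hom_module R M N)" and g: "g \<in> carrier (hom_module R M N)"
    then show "f \<oplus>\<^bsub>hom_module R M N\<^esub> g \<in> carrier (hom_module R M N)" using add by simp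
    show "f \<oplus>\<^bsub>hom_module R M N\<^esub> g = g \<oplus>\<^bsub>hom_module R M N\<^esub> f"
      using f g by (auto simp: mod_hom_closed N.a_comm intro!: restrict_ext)
    fix h assume "h \<in> carrier (hom_module R M N)"
    then show "f \<oplus>\<^bsub>hom_module R M N\<^esub> g \<oplus>\<^bsub>hom_module R M N\<^esub> h =
        f \<oplus>\<^bsub>hom_module R M N\<^esub> (g \<oplus>\<^bsub>hom_module R M N\<^esub> h)"
      using f g by (auto simp: mod_hom_closed N.a_assoc intro!: restrict_ext)
  next
    fix f assume "f \<in> carrier (hom_module R M N)"
    then have f: "f \<in> mod_hom R M N" by simp
    then show "\<zero>\<^bsub>hom_module R M N\<^esub> \<oplus>\<^bsub>hom_module R M N\<^esub> f = f"
      by (auto intro!: extensionalityI[of _ "carrier M"] simp: mod_hom_extensional mod_hom_closed)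
    show "\<exists>g\<in>carrier (hom_module R M N).
        g \<oplus>\<^bsub>hom_module R M N\<^esub> f = \<zero>\<^bsub>hom_module R M N\<^esub>"
      using mod_hom_diff[OF M N zero f] mod_hom_closed[OF f]
      by (intro bexI) (auto intro!: restrict_ext simp: a_minus_def N.l_neg)
  qed (use zero in simp)
qed

definition res_rank :: "'a ring \<Rightarrow> ('a, 'b) module \<Rightarrow> nat \<Rightarrow> nat" where
  "res_rank R M n =
     (case n of 0 \<Rightarrow> fst (cover R M) | Suc k \<Rightarrow> fst (cover R (syzygy_Suc R M k)))"

lemma res_module_eq: "res_module R M n = free_module R (res_rank R M n)"
  by (simp add: res_module_def res_rank_def)

lemma syzygy_Suc_syzygy_Suc:
  "syzygy_Suc R (syzygy_Suc R M k) n = syzygy_Suc R M (Suc (k + n))"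
  by (induction n) auto

lemma res_module_syzygy_Suc: "res_module R (syzygy_Suc R M k) n = res_module R M (Suc (k + n))"
  by (cases n) (simp_all add: res_module_def syzygy_Suc_syzygy_Suc)

lemma coboundary_syzygy_Suc:
  "coboundary R (syzygy_Suc R M k) n = coboundary R M (Suc (k + n))"
  by (rule ext) (simp add: coboundary_def res_module_syzygy_Suc res_diff_def syzygy_Suc_syzygy_Suc)

text \<open>
  The chosen resolution of a syzygy is a tail of that of the module. Hence this is an equality of
  groups and not just an isomorphism.
\<close>

lemma Ext_syzygy_Suc: "Ext R (Suc i) (syzygy_Suc R M k) N = Ext R (Suc (Suc (k + i))) M N"
  by (simp add: Ext_def cocycles_def coboundaries_def cochains_def
      res_module_syzygy_Suc coboundary_syzygy_Suc)

text \<open>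
  A map killing the kernel of \<open>q\<close> is one defined on the image of \<open>q\<close>; the condition is that
  it extends from there to the target of \<open>q\<close>. In this form the vanishing of Ext can be used
  without passing to cosets.
\<close>

definition extends_from_image ::
  "'a ring \<Rightarrow> ('a, 'c) module \<Rightarrow> ('a, 'd) module \<Rightarrow> ('c \<Rightarrow> 'd) \<Rightarrow> ('a, 'e) module \<Rightarrow> bool" where
  "extends_from_image R E F q N \<longleftrightarrow>
     (\<forall>f\<in>mod_hom R E N. (\<forall>y\<in>carrier E. q y = \<zero>\<^bsub>F\<^esub> \<longrightarrow> f y = \<zero>\<^bsub>N\<^esub>) \<longrightarrow>
        (\<exists>g\<in>mod_hom R F N. \<forall>y\<in>carrier E. f y = g (q y)))"

context local_base
begin

lemma first_syzygy_submodule: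
  assumes "fg_module R M"
  shows "submodule (carrier (first_syzygy R M)) R (free_module R (fst (cover R M)))"
  using kernel_submodule[OF free_module_module, of M "snd (cover R M)"] assms
    cover_minimal_free_cover[OF assms]
  by (simp add: first_syzygy_def Let_def minimal_free_cover_def fg_module_def)

lemma fg_first_syzygy:
  assumes "fg_module R M"
  shows "fg_module R (first_syzygy R M)"
  using submodule_free_fg_module[OF first_syzygy_submodule[OF assms]]
  by (simp add: first_syzygy_def Let_def)

lemma fg_syzygy_Suc:
  assumes "fg_module R M"
  shows "fg_module R (syzygy_Suc R M n)"
  by (induction n) (simp_all add: assms fg_first_syzygy)

lemma first_syzygy_carrier:
  "carrier (first_syzygy R M) = {x \<in> carrier (free_module R (fst (cover R M))). snd (cover R M) x = \<zero>\<^bsub>M\<^esub>}"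
  by (simp add: first_syzygy_def Let_def a_kernel_def')

lemma syzygy_Suc_eq:
  "syzygy_Suc R M n = (res_module R M n)\<lparr>carrier := carrier (syzygy_Suc R M n)\<rparr>"
  by (cases n) (simp_all add: first_syzygy_def Let_def res_module_def)

lemma syzygy_Suc_zero: "\<zero>\<^bsub>syzygy_Suc R M n\<^esub> = \<zero>\<^bsub>res_module R M n\<^esub>"
  by (subst syzygy_Suc_eq) simp

lemma syzygy_Suc_minimal:
  assumes "fg_module R M"
  shows "carrier (syzygy_Suc R M n) \<subseteq> {..<res_rank R M n} \<rightarrow>\<^sub>E \<mm>"
  using cover_minimal_free_cover[OF assms] cover_minimal_free_cover[OF fg_syzygy_Suc[OF assms]]
  by (cases n) (simp_all add: first_syzygy_def Let_def minimal_free_cover_def res_rank_def)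

lemma syzygy_Suc_subset:
  assumes "fg_module R M"
  shows "carrier (syzygy_Suc R M n) \<subseteq> carrier (res_module R M n)"
  using syzygy_Suc_minimal[OF assms, of n] maximal_ideal_subset
  by (force simp: res_module_eq PiE_iff)

lemma res_diff_surj:
  assumes "fg_module R M"
  shows "res_diff R M n ` carrier (res_module R M (Suc n)) = carrier (syzygy_Suc R M n)"
  using cover_minimal_free_cover[OF fg_syzygy_Suc[OF assms, of n]]
  by (simp add: minimal_free_cover_def res_diff_def res_module_def)

lemma res_diff_onto_syzygy_hom:
  assumes "fg_module R M"
  shows "res_diff R M n \<in> mod_hom R (res_module R M (Suc n)) (syzygy_Suc R M n)"
  using cover_minimal_free_cover[OF fg_syzygy_Suc[OF assms, of n]]
  by (simp add: minimal_free_cover_def res_diff_def res_module_def)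

lemma res_diff_hom:
  assumes "fg_module R M"
  shows "res_diff R M n \<in> mod_hom R (res_module R M (Suc n)) (res_module R M n)"
proof (rule mod_hom_from_submodule)
  show "res_diff R M n
      \<in> mod_hom R (res_module R M (Suc n)) (res_module R M n\<lparr>carrier := carrier (syzygy_Suc R M n)\<rparr>)"
    using res_diff_onto_syzygy_hom[OF assms, of n] syzygy_Suc_eq[of M n] by simp
qed (rule syzygy_Suc_subset[OF assms])

lemma res_exact:
  assumes "fg_module R M" "y \<in> carrier (res_module R M (Suc n))"
  shows "res_diff R M n y = \<zero>\<^bsub>res_module R M n\<^esub> \<longleftrightarrow>
    (\<exists>x\<in>carrier (res_module R M (Suc (Suc n))). y = res_diff R M (Suc n) x)"
proof -
  have "res_diff R M n y = \<zero>\<^bsub>res_module R M n\<^esub> \<longleftrightarrow> y \<in> carrier (syzygy_Suc R M (Suc n))"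
    using assms(2) syzygy_Suc_zero[of M n]
    by (simp add: first_syzygy_carrier res_diff_def res_module_def)
  then show ?thesis using res_diff_surj[OF assms(1), of "Suc n"] by auto
qed

lemma res_module_module: "module R (res_module R M n)"
  by (simp add: res_module_eq free_module_module)

lemma cochains_abelian_group:
  assumes "module R N"
  shows "abelian_group (cochains R M N n)"
  unfolding cochains_def by (rule hom_module_abelian_group[OF res_module_module assms])

lemma coboundary_hom:
  assumes M: "fg_module R M" and N: "module R N"
  shows "abelian_group_hom (cochains R M N n) (cochains R M N (Suc n)) (coboundary R M n)"
proof (rule abelian_group_homI)
  show "abelian_group (cochains R M N n)" "abelian_group (cochains R M N (Suc n))"
    by (rule cochains_abelian_group[OF N])+
  note d = res_diff_hom[OF M, of n]
  show "group_hom (add_monoid (cochains R M N n)) (add_monoid (cochains R M N (Suc n))) (coboundary R M n)"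
    unfolding group_hom_def group_hom_axioms_def
  proof (intro conjI homI)
    show "group (add_monoid (cochains R M N n))" "group (add_monoid (cochains R M N (Suc n)))"
      by (rule abelian_group.a_group[OF cochains_abelian_group[OF N]])+
    fix f assume f: "f \<in> carrier (add_monoid (cochains R M N n))"
    then show "coboundary R M n f \<in> carrier (add_monoid (cochains R M N (Suc n)))"
      using mod_hom_compose[OF res_module_module d] by (simp add: cochains_def coboundary_def)
    fix g assume g: "g \<in> carrier (add_monoid (cochains R M N n))"
    show "coboundary R M n (f \<otimes>\<^bsub>add_monoid (cochains R M N n)\<^esub> g) =
      coboundary R M n f \<otimes>\<^bsub>add_monoid (cochains R M N (Suc n))\<^esub> coboundary R M n g"
      using mod_hom_closed[OF d] by (auto simp: cochains_def coboundary_def compose_def intro!: restrict_ext)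
  qed
qed

lemma cocycles_Suc:
  assumes M: "fg_module R M"
  shows "cocycles R M N (Suc n) = {f \<in> mod_hom R (res_module R M (Suc n)) N.
    \<forall>y\<in>carrier (res_module R M (Suc n)). res_diff R M n y = \<zero>\<^bsub>res_module R M n\<^esub> \<longrightarrow> f y = \<zero>\<^bsub>N\<^esub>}"
proof -
  have "coboundary R M (Suc n) f = \<zero>\<^bsub>cochains R M N (Suc (Suc n))\<^esub> \<longleftrightarrow>
    (\<forall>y\<in>carrier (res_module R M (Suc n)). res_diff R M n y = \<zero>\<^bsub>res_module R M n\<^esub> \<longrightarrow> f y = \<zero>\<^bsub>N\<^esub>)" for f
  proof -
    let ?F = "carrier (res_module R M (Suc (Suc n)))"
    have "coboundary R M (Suc n) f = \<zero>\<^bsub>cochains R M N (Suc (Suc n))\<^esub> \<longleftrightarrow>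
        (\<forall>x\<in>?F. f (res_diff R M (Suc n) x) = \<zero>\<^bsub>N\<^esub>)"
      by (simp add: cochains_def coboundary_def compose_def fun_eq_iff restrict_def) blast
    then show ?thesis
      using res_exact[OF M, of _ n] mod_hom_closed[OF res_diff_hom[OF M, of "Suc n"]] by blast
  qed
  then show ?thesis by (simp add: cocycles_def a_kernel_def' cochains_def[of R M N "Suc n"])
qed

lemma coboundaries_Suc:
  "coboundaries R M N (Suc n) =
     {compose (carrier (res_module R M (Suc n))) g (res_diff R M n) | g. g \<in> mod_hom R (res_module R M n) N}"
  by (auto simp: coboundaries_def cochains_def coboundary_def)

lemma coboundaries_subset_cocycles:
  assumes M: "fg_module R M" and N: "module R N"
  shows "coboundaries R M N (Suc n) \<subseteq> cocycles R M N (Suc n)"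
  using mod_hom_compose[OF res_module_module res_diff_hom[OF M, of n]]
    mod_hom_zero[OF res_module_module N]
  by (auto simp: cocycles_Suc[OF M] coboundaries_Suc compose_def)

text \<open>
  The resolution is exact at \<open>F\<^sub>n\<^sub>+\<^sub>1\<close>, so a cocycle is the same as a map defined on the image of
  \<open>F\<^sub>n\<^sub>+\<^sub>1 \<rightarrow> F\<^sub>n\<close>, and it is a coboundary if that map extends to \<open>F\<^sub>n\<close>.
\<close>

lemma Ext_zero_iff_extends:
  assumes M: "fg_module R M" and N: "module R N"
  shows "Ext_zero R (Suc n) M N \<longleftrightarrow>
    extends_from_image R (res_module R M (Suc n)) (res_module R M n) (res_diff R M n) N"
proof -
  let ?C = "cochains R M N (Suc n)" and ?Z = "cocycles R M N (Suc n)"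
  let ?B = "coboundaries R M N (Suc n)" and ?d = "res_diff R M n"
  let ?E = "res_module R M (Suc n)"
  define G where "G = (add_monoid ?C)\<lparr>carrier := ?Z\<rparr>"
  interpret C: abelian_group ?C by (rule cochains_abelian_group[OF N])
  interpret d: abelian_group_hom "cochains R M N n" ?C "coboundary R M n"
    by (rule coboundary_hom[OF M N])
  interpret d': abelian_group_hom ?C "cochains R M N (Suc (Suc n))" "coboundary R M (Suc n)"
    by (rule coboundary_hom[OF M N])
  have Z: "subgroup ?Z (add_monoid ?C)"
    using d'.additive_subgroup_a_kernel by (simp add: additive_subgroup_def cocycles_def)
  interpret G: group G unfolding G_def by (rule subgroup.subgroup_is_group[OF Z C.a_group])
  have Gs: "carrier G = ?Z" "\<one>\<^bsub>G\<^esub> = \<zero>\<^bsub>?C\<^esub>" "x \<otimes>\<^bsub>G\<^esub> y = x \<oplus>\<^bsub>?C\<^esub> y" for x y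
    by (simp_all add: G_def)
  have Ext: "Ext R (Suc n) M N = G Mod ?B" by (simp add: Ext_def G_def)
  have BZ: "?B \<subseteq> ?Z" by (rule coboundaries_subset_cocycles[OF M N])
  have ZC: "?Z \<subseteq> carrier ?C" using subgroup.subset[OF Z] by simp
  have zB: "\<zero>\<^bsub>?C\<^esub> \<in> ?B"
    using d.hom_zero unfolding coboundaries_def by (auto intro!: image_eqI[of _ _ "\<zero>\<^bsub>cochains R M N n\<^esub>"])
  have "trivial_group (G Mod ?B) \<longleftrightarrow> ?Z \<subseteq> ?B"
  proof
    assume "trivial_group (G Mod ?B)"
    then have triv: "(\<lambda>z. ?B #>\<^bsub>G\<^esub> z) ` ?Z = {?B}"
      by (simp add: trivial_group_def FactGroup_def RCOSETS_def Gs(1) UNION_singleton_eq_range)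
    show "?Z \<subseteq> ?B"
    proof
      fix z assume z: "z \<in> ?Z"
      then have "?B #>\<^bsub>G\<^esub> z = ?B" using triv by blast
      moreover have "\<zero>\<^bsub>?C\<^esub> \<otimes>\<^bsub>G\<^esub> z \<in> ?B #>\<^bsub>G\<^esub> z" unfolding r_coset_def using zB by blast
      ultimately show "z \<in> ?B" using z ZC by (auto simp: Gs)
    qed
  next
    assume "?Z \<subseteq> ?B"
    then have eq: "?B = carrier G" using BZ Gs by auto
    have sub: "subgroup (carrier G) G" by (rule G.subgroup_self)
    have "carrier G \<lhd> G"
      using G.normal_inv_iff sub by simp
    then have "group (G Mod carrier G)" by (rule normal.factorgroup_is_group)
    moreover have "carrier (G Mod carrier G) = {carrier G}"
      using G.coset_join2[OF _ sub] G.one_closed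
      by (auto simp: FactGroup_def RCOSETS_def)
    ultimately show "trivial_group (G Mod ?B)"
      unfolding eq trivial_group_def by (simp add: FactGroup_def)
  qed
  also have "\<dots> \<longleftrightarrow> extends_from_image R ?E (res_module R M n) ?d N"
  proof -
    have "f \<in> ?B \<longleftrightarrow> (\<exists>g\<in>mod_hom R (res_module R M n) N. \<forall>y\<in>carrier ?E. f y = g (?d y))"
      if f: "f \<in> mod_hom R ?E N" for f
    proof -
      have "f = compose (carrier ?E) g ?d \<longleftrightarrow> (\<forall>y\<in>carrier ?E. f y = g (?d y))" for g
        using mod_hom_extensional[OF f]
        by (auto simp: compose_def intro!: extensionalityI[of _ "carrier ?E"])
      then show ?thesis by (auto simp: coboundaries_Suc)
    qed
    then show ?thesis by (auto simp: cocycles_Suc[OF M] extends_from_image_def subset_iff)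
  qed
  finally show ?thesis by (simp add: Ext)
qed

end

section \<open>Dimension shifting in the second argument\<close>

lemma extends_from_imageE:
  assumes "extends_from_image R E F q N" "f \<in> mod_hom R E N"
    and "\<And>y. y \<in> carrier E \<Longrightarrow> q y = \<zero>\<^bsub>F\<^esub> \<Longrightarrow> f y = \<zero>\<^bsub>N\<^esub>"
  obtains g where "g \<in> mod_hom R F N" "\<And>y. y \<in> carrier E \<Longrightarrow> f y = g (q y)"
  using assms by (auto simp: extends_from_image_def)

context local_base
begin

text \<open>A map to \<open>R\<^sup>k\<close> extends coordinate by coordinate.\<close>

lemma extends_from_image_free:
  assumes E: "module R E" and F: "module R F" and q: "q \<in> mod_hom R E F"
    and ext: "extends_from_image R E F q (self_module R)"
  shows "extends_from_image R E F q (free_module R k)"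
  unfolding extends_from_image_def
proof (intro ballI impI)
  fix f assume f: "f \<in> mod_hom R E (free_module R k)"
    and ker: "\<forall>y\<in>carrier E. q y = \<zero>\<^bsub>F\<^esub> \<longrightarrow> f y = \<zero>\<^bsub>free_module R k\<^esub>"
  have "\<exists>g. g \<in> mod_hom R F (self_module R) \<and> (\<forall>y\<in>carrier E. f y j = g (q y))" if j: "j < k" for j
  proof -
    let ?c = "compose (carrier E) (\<lambda>x\<in>carrier (free_module R k). x j) f"
    have c: "?c \<in> mod_hom R E (self_module R)"
      by (rule mod_hom_compose[OF E f coordinate_mod_hom[OF j]])
    have cy: "?c y = f y j" if "y \<in> carrier E" for y
      using that mod_hom_closed[OF f that] by (simp add: compose_def)
    have c0: "?c y = \<zero>\<^bsub>self_module R\<^esub>" if "y \<in> carrier E" "q y = \<zero>\<^bsub>F\<^esub>" for y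
      unfolding cy[OF that(1)] using ker that j by simp
    obtain g where "g \<in> mod_hom R F (self_module R)" "\<And>y. y \<in> carrier E \<Longrightarrow> ?c y = g (q y)"
      using extends_from_imageE[OF ext c c0] by blast
    then show ?thesis using cy by (intro exI[of _ g]) simp
  qed
  then have "\<forall>j. \<exists>g. j < k \<longrightarrow> g \<in> mod_hom R F (self_module R) \<and> (\<forall>y\<in>carrier E. f y j = g (q y))"
    by blast
  then obtain g where "\<forall>j. j < k \<longrightarrow> g j \<in> mod_hom R F (self_module R) \<and> (\<forall>y\<in>carrier E. f y j = g j (q y))"
    by (rule choice[THEN exE])
  then have g: "\<And>j. j < k \<Longrightarrow> g j \<in> mod_hom R F (self_module R)"
    and gq: "\<And>j y. j < k \<Longrightarrow> y \<in> carrier E \<Longrightarrow> f y j = g j (q y)"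
    by auto
  show "\<exists>h\<in>mod_hom R F (free_module R k). \<forall>y\<in>carrier E. f y = h (q y)"
  proof (rule bexI[OF _ mod_hom_free_tuple[OF F g]], intro ballI)
    fix y assume y: "y \<in> carrier E"
    have "f y = (\<lambda>i\<in>{..<k}. g i (q y))"
    proof (rule extensionalityI[of _ "{..<k}"])
      show "f y \<in> extensional {..<k}" using mod_hom_closed[OF f y] by (auto simp: PiE_iff)
    qed (use gq y in simp_all)
    then show "f y = (\<lambda>x\<in>carrier F. \<lambda>i\<in>{..<k}. g i x) (q y)" using mod_hom_closed[OF q y] by simp
  qed
qed

lemma Ext_zero_free_module:
  assumes M: "fg_module R M" and "Ext_zero R (Suc i) M (self_module R)"
  shows "Ext_zero R (Suc i) M (free_module R k)"
  using assms(2) extends_from_image_free[OF res_module_module res_module_module res_diff_hom[OF M]]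
  by (simp only: Ext_zero_iff_extends[OF M self_module_module] Ext_zero_iff_extends[OF M free_module_module])

text \<open>
  This is the part of the long exact sequence of \<open>Ext(M, -)\<close> on \<open>0 \<rightarrow> \<Omega>N \<rightarrow> F \<rightarrow> N \<rightarrow> 0\<close>
  between two vanishing groups \<open>Ext(M, F)\<close>. Since maps out of the terms of the resolution lift
  along \<open>F \<rightarrow> N\<close>, the diagram chase can be done on the level of cochains.
\<close>

lemma Ext_zero_shift:
  assumes M: "fg_module R M" and N: "fg_module R N"
    and vanish: "Ext_zero R (Suc i) M (self_module R)" "Ext_zero R (Suc (Suc i)) M (self_module R)"
  shows "Ext_zero R (Suc i) M N \<longleftrightarrow> Ext_zero R (Suc (Suc i)) M (first_syzygy R N)"
proof -
  let ?E0 = "res_module R M i" and ?E1 = "res_module R M (Suc i)" and ?E2 = "res_module R M (Suc (Suc i))"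
  let ?d0 = "res_diff R M i" and ?d1 = "res_diff R M (Suc i)"
  define F where "F = free_module R (fst (cover R N))"
  define p where "p = snd (cover R N)"
  let ?K = "first_syzygy R N"
  have Nm: "module R N" and Km: "module R ?K"
    using N fg_first_syzygy[OF N] by (simp_all add: fg_module_def)
  have Fm: "module R F" by (simp add: F_def free_module_module)
  interpret N: module R N by (rule Nm)
  interpret F: module R F by (rule Fm)
  interpret E1: module R ?E1 by (rule res_module_module)
  have p: "p \<in> mod_hom R F N" and surj: "p ` carrier F = carrier N"
    using cover_minimal_free_cover[OF N] by (simp_all add: minimal_free_cover_def p_def F_def)
  have Keq: "?K = F\<lparr>carrier := carrier ?K\<rparr>" by (simp add: first_syzygy_def Let_def F_def)
  have Kz: "\<zero>\<^bsub>?K\<^esub> = \<zero>\<^bsub>F\<^esub>" by (subst Keq) simp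
  have Kc: "x \<in> carrier ?K \<longleftrightarrow> x \<in> carrier F \<and> p x = \<zero>\<^bsub>N\<^esub>" for x
    by (simp add: first_syzygy_carrier F_def p_def)
  have into_K: "f \<in> mod_hom R E ?K"
    if "f \<in> mod_hom R E F" "\<And>x. x \<in> carrier E \<Longrightarrow> p (f x) = \<zero>\<^bsub>N\<^esub>"
    for f and E :: "('a, nat \<Rightarrow> 'a) module"
    using mod_hom_into_submodule[OF that(1), where H = "carrier ?K"] that mod_hom_closed[OF that(1)] Kc Keq
    by simp
  have from_K: "f \<in> mod_hom R E F" if "f \<in> mod_hom R E ?K" for f and E :: "('a, nat \<Rightarrow> 'a) module"
    using mod_hom_from_submodule[where f = f and M = E and N = F and H = "carrier ?K"] that Kc Keq by auto
  note d0 = res_diff_hom[OF M, of i] and d1 = res_diff_hom[OF M, of "Suc i"]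
  have exact: "?d0 y = \<zero>\<^bsub>?E0\<^esub> \<longleftrightarrow> (\<exists>x\<in>carrier ?E2. y = ?d1 x)" if "y \<in> carrier ?E1" for y
    by (rule res_exact[OF M that])
  have dd: "?d0 (?d1 x) = \<zero>\<^bsub>?E0\<^esub>" if "x \<in> carrier ?E2" for x
    using exact[of "?d1 x"] mod_hom_closed[OF d1 that] that by blast
  have lift: "\<exists>g\<in>mod_hom R (res_module R M j) F. \<forall>a\<in>carrier (res_module R M j). p (g a) = f a"
    if "f \<in> mod_hom R (res_module R M j) N" for f j
    using free_hom_lift[OF Fm Nm p surj, of f "res_rank R M j"] that by (simp only: res_module_eq)
  have ext0: "extends_from_image R ?E1 ?E0 ?d0 F" and ext1: "extends_from_image R ?E2 ?E1 ?d1 F"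
    using vanish[THEN Ext_zero_free_module[OF M], of "fst (cover R N)"]
    by (simp_all only: Ext_zero_iff_extends[OF M free_module_module] F_def)
  have "extends_from_image R ?E1 ?E0 ?d0 N \<longleftrightarrow> extends_from_image R ?E2 ?E1 ?d1 ?K"
  proof
    assume extN: "extends_from_image R ?E1 ?E0 ?d0 N"
    show "extends_from_image R ?E2 ?E1 ?d1 ?K"
      unfolding extends_from_image_def
    proof (intro ballI impI)
      fix f assume f: "f \<in> mod_hom R ?E2 ?K"
        and ker: "\<forall>y\<in>carrier ?E2. ?d1 y = \<zero>\<^bsub>?E1\<^esub> \<longrightarrow> f y = \<zero>\<^bsub>?K\<^esub>"
      \<comment> \<open>As a map to \<open>F\<close>, \<open>f\<close> is a coboundary; \<open>g\<close> is then corrected so as to land in \<open>\<Omega>N\<close>.\<close>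
      obtain g where g: "g \<in> mod_hom R ?E1 F" and fg: "\<And>y. y \<in> carrier ?E2 \<Longrightarrow> f y = g (?d1 y)"
        using extends_from_imageE[OF ext1 from_K[OF f]] ker Kz by metis
      let ?pg = "compose (carrier ?E1) p g"
      have pg: "?pg \<in> mod_hom R ?E1 N" by (rule mod_hom_compose[OF res_module_module g p])
      have pg0: "?pg y = \<zero>\<^bsub>N\<^esub>" if y: "y \<in> carrier ?E1" "?d0 y = \<zero>\<^bsub>?E0\<^esub>" for y
      proof -
        obtain x where x: "x \<in> carrier ?E2" "y = ?d1 x" using exact y by auto
        have "p (f x) = \<zero>\<^bsub>N\<^esub>" using mod_hom_closed[OF f x(1)] Kc by simp
        then show ?thesis using x y fg by (simp add: compose_def)
      qed
      obtain h where h: "h \<in> mod_hom R ?E0 N" and hd: "\<And>y. y \<in> carrier ?E1 \<Longrightarrow> ?pg y = h (?d0 y)"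
        using extends_from_imageE[OF extN pg pg0] by blast
      obtain h' where h': "h' \<in> mod_hom R ?E0 F" and ph': "\<And>a. a \<in> carrier ?E0 \<Longrightarrow> p (h' a) = h a"
        using lift[OF h] by blast
      let ?hd = "compose (carrier ?E1) h' ?d0"
      have hd': "?hd \<in> mod_hom R ?E1 F" by (rule mod_hom_compose[OF res_module_module d0 h'])
      define g' where "g' = (\<lambda>x\<in>carrier ?E1. g x \<ominus>\<^bsub>F\<^esub> ?hd x)"
      have "g' \<in> mod_hom R ?E1 F" unfolding g'_def by (rule mod_hom_diff[OF res_module_module Fm g hd'])
      moreover have "p (g' y) = \<zero>\<^bsub>N\<^esub>" if y: "y \<in> carrier ?E1" for y
      proof -
        have "p (g' y) = p (g y) \<ominus>\<^bsub>N\<^esub> p (?hd y)"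
          using mod_hom_minus[OF Fm Nm p mod_hom_closed[OF g y] mod_hom_closed[OF hd' y]] y by (simp add: g'_def)
        also have "p (?hd y) = p (g y)"
          using hd[OF y] y ph'[OF mod_hom_closed[OF d0 y]] by (simp add: compose_def)
        finally show ?thesis using mod_hom_closed[OF p mod_hom_closed[OF g y]] by (simp add: a_minus_def N.r_neg)
      qed
      ultimately have g'K: "g' \<in> mod_hom R ?E1 ?K" by (rule into_K)
      have "f y = g' (?d1 y)" if y: "y \<in> carrier ?E2" for y
      proof -
        have dy: "?d1 y \<in> carrier ?E1" by (rule mod_hom_closed[OF d1 y])
        have "?hd (?d1 y) = \<zero>\<^bsub>F\<^esub>"
          using dy dd[OF y] mod_hom_zero[OF res_module_module Fm h'] by (simp add: compose_def)
        then have "g' (?d1 y) = g (?d1 y) \<ominus>\<^bsub>F\<^esub> \<zero>\<^bsub>F\<^esub>" using dy by (simp add: g'_def)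
        then show ?thesis using fg[OF y] mod_hom_closed[OF g dy] by (simp add: a_minus_def)
      qed
      then show "\<exists>g\<in>mod_hom R ?E1 ?K. \<forall>y\<in>carrier ?E2. f y = g (?d1 y)" using g'K by blast
    qed
  next
    assume extK: "extends_from_image R ?E2 ?E1 ?d1 ?K"
    show "extends_from_image R ?E1 ?E0 ?d0 N"
      unfolding extends_from_image_def
    proof (intro ballI impI)
      fix f assume f: "f \<in> mod_hom R ?E1 N"
        and ker: "\<forall>y\<in>carrier ?E1. ?d0 y = \<zero>\<^bsub>?E0\<^esub> \<longrightarrow> f y = \<zero>\<^bsub>N\<^esub>"
      \<comment> \<open>The coboundary of a lift \<open>f'\<close> represents the connecting image of \<open>f\<close>; as that is zero in
        \<open>Ext(M, \<Omega>N)\<close>, the lift can be changed by a map to \<open>\<Omega>N\<close> into a cocycle.\<close>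
      obtain f' where f': "f' \<in> mod_hom R ?E1 F" and pf': "\<And>a. a \<in> carrier ?E1 \<Longrightarrow> p (f' a) = f a"
        using lift[OF f] by blast
      let ?fd = "compose (carrier ?E2) f' ?d1"
      have "?fd \<in> mod_hom R ?E2 F" by (rule mod_hom_compose[OF res_module_module d1 f'])
      moreover have "p (?fd x) = \<zero>\<^bsub>N\<^esub>" if x: "x \<in> carrier ?E2" for x
        using pf'[OF mod_hom_closed[OF d1 x]] ker dd[OF x] mod_hom_closed[OF d1 x] x
        by (simp add: compose_def)
      ultimately have fd: "?fd \<in> mod_hom R ?E2 ?K" by (rule into_K)
      have fd0: "?fd y = \<zero>\<^bsub>?K\<^esub>" if "y \<in> carrier ?E2" "?d1 y = \<zero>\<^bsub>?E1\<^esub>" for y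
        using that mod_hom_zero[OF res_module_module Fm f'] Kz by (simp add: compose_def)
      obtain g where g: "g \<in> mod_hom R ?E1 ?K" and gd: "\<And>y. y \<in> carrier ?E2 \<Longrightarrow> ?fd y = g (?d1 y)"
        using extends_from_imageE[OF extK fd fd0] by blast
      define u where "u = (\<lambda>x\<in>carrier ?E1. f' x \<ominus>\<^bsub>F\<^esub> g x)"
      have u: "u \<in> mod_hom R ?E1 F"
        unfolding u_def by (rule mod_hom_diff[OF res_module_module Fm f' from_K[OF g]])
      have u0: "u y = \<zero>\<^bsub>F\<^esub>" if y: "y \<in> carrier ?E1" "?d0 y = \<zero>\<^bsub>?E0\<^esub>" for y
      proof -
        obtain x where x: "x \<in> carrier ?E2" "y = ?d1 x" using exact y by auto
        then have "f' y = g y" using gd[OF x(1)] by (simp add: compose_def)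
        then show ?thesis using y mod_hom_closed[OF f' y(1)] by (simp add: u_def a_minus_def F.r_neg)
      qed
      obtain h where h: "h \<in> mod_hom R ?E0 F" and uh: "\<And>y. y \<in> carrier ?E1 \<Longrightarrow> u y = h (?d0 y)"
        using extends_from_imageE[OF ext0 u u0] by blast
      let ?ph = "compose (carrier ?E0) p h"
      have ph: "?ph \<in> mod_hom R ?E0 N" by (rule mod_hom_compose[OF res_module_module h p])
      have "f y = ?ph (?d0 y)" if y: "y \<in> carrier ?E1" for y
      proof -
        have gy: "g y \<in> carrier F" "p (g y) = \<zero>\<^bsub>N\<^esub>" using mod_hom_closed[OF g y] Kc by auto
        have "?ph (?d0 y) = p (u y)" using uh[OF y] mod_hom_closed[OF d0 y] by (simp add: compose_def)
        also have "\<dots> = p (f' y) \<ominus>\<^bsub>N\<^esub> p (g y)"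
          using mod_hom_minus[OF Fm Nm p mod_hom_closed[OF f' y] gy(1)] y by (simp add: u_def)
        also have "\<dots> = f y" using gy(2) pf'[OF y] mod_hom_closed[OF f y] by (simp add: a_minus_def)
        finally show ?thesis by simp
      qed
      then show "\<exists>g\<in>mod_hom R ?E0 N. \<forall>y\<in>carrier ?E1. f y = g (?d0 y)" using ph by blast
    qed
  qed
  then show ?thesis by (simp only: Ext_zero_iff_extends[OF M Nm] Ext_zero_iff_extends[OF M Km])
qed

end

section \<open>Freeness from minimality\<close>

context local_base
begin

text \<open>
  Nakayama's lemma for the module with minimal cover \<open>q\<close>. As \<open>\<mm>N\<close> is the image of \<open>\<mm>F\<close>, equality
  would put the basis element, up to the kernel and hence altogether, into \<open>\<mm>F\<close>.
\<close>

lemma minimal_free_cover_basis_image: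
  assumes N: "module R N" and cov: "minimal_free_cover R N n q" and n: "0 < n"
    and w: "w \<in> {..<n} \<rightarrow>\<^sub>E \<mm>"
  shows "q w \<noteq> q (unit_vec n 0)"
proof
  let ?F = "free_module R n"
  assume eq: "q w = q (unit_vec n 0)"
  interpret F: module R ?F by (rule free_module_module)
  interpret N: module R N by (rule N)
  interpret I: ideal \<mm> R by (rule ideal_maximal_ideal)
  have q: "q \<in> mod_hom R ?F N" and ker: "a_kernel ?F N q \<subseteq> {..<n} \<rightarrow>\<^sub>E \<mm>"
    using cov by (simp_all add: minimal_free_cover_def)
  have wF: "w \<in> carrier ?F" using w maximal_ideal_subset by (auto simp: PiE_iff)
  have eF: "unit_vec n 0 \<in> carrier ?F" by simp
  define v where "v = unit_vec n 0 \<ominus>\<^bsub>?F\<^esub> w"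
  have vF: "v \<in> carrier ?F" unfolding v_def by (rule F.minus_closed[OF eF wF])
  have "q v = \<zero>\<^bsub>N\<^esub>"
    unfolding v_def mod_hom_minus[OF free_module_module N q eF wF] eq
    using mod_hom_closed[OF q eF] by (simp add: a_minus_def N.r_neg)
  then have "v \<in> {..<n} \<rightarrow>\<^sub>E \<mm>" using vF ker by (auto simp: a_kernel_def')
  then have "v 0 \<in> \<mm>" "w 0 \<in> \<mm>" using w n by (auto simp: PiE_iff)
  moreover have "v \<oplus>\<^bsub>?F\<^esub> w = unit_vec n 0"
    unfolding v_def a_minus_def
    using F.a_assoc[OF eF F.a_inv_closed[OF wF] wF] F.l_neg[OF wF] F.r_zero[OF eF] by metis
  from fun_cong[OF this, of 0] have "v 0 \<oplus> w 0 = \<one>" using n by (simp add: unit_vec_def)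
  ultimately show False using one_notin_maximal_ideal I.a_closed by metis
qed

lemma res_diff_minimal_free_cover:
  assumes "fg_module R M"
  shows "minimal_free_cover R (syzygy_Suc R M i) (res_rank R M (Suc i)) (res_diff R M i)"
  using cover_minimal_free_cover[OF fg_syzygy_Suc[OF assms, of i]]
  by (simp add: res_diff_def res_rank_def)

text \<open>
  The differential, as a map to \<open>\<Omega>\<^sup>i\<^sup>+\<^sup>1M\<close>, is a cocycle; that it is a coboundary means that the
  identity of \<open>\<Omega>\<^sup>i\<^sup>+\<^sup>1M\<close> extends to \<open>F\<^sub>i\<close>. The vanishing thus makes \<open>\<Omega>\<^sup>i\<^sup>+\<^sup>1M\<close> a direct summand of
  \<open>F\<^sub>i\<close>, yet it lies in \<open>\<mm>F\<^sub>i\<close>.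
\<close>

lemma syzygy_vanishes_if_split:
  assumes M: "fg_module R M" and ext: "Ext_zero R (Suc i) M (syzygy_Suc R M i)"
  shows "res_rank R M (Suc i) = 0"
proof (rule ccontr)
  assume nz: "res_rank R M (Suc i) \<noteq> 0"
  let ?K = "syzygy_Suc R M i" and ?d = "res_diff R M i" and ?b = "res_rank R M (Suc i)"
  let ?E0 = "res_module R M i" and ?E1 = "res_module R M (Suc i)"
  have K: "module R ?K" using fg_syzygy_Suc[OF M] by (simp add: fg_module_def)
  have dK: "?d \<in> mod_hom R ?E1 ?K" by (rule res_diff_onto_syzygy_hom[OF M])
  have ext': "extends_from_image R ?E1 ?E0 ?d ?K" using ext by (simp only: Ext_zero_iff_extends[OF M K])
  obtain g where g: "g \<in> mod_hom R ?E0 ?K" and gd: "\<And>y. y \<in> carrier ?E1 \<Longrightarrow> ?d y = g (?d y)"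
    using extends_from_imageE[OF ext' dK] syzygy_Suc_zero[of M i] by metis
  \<comment> \<open>A lift of the retraction \<open>g\<close> to \<open>F\<^sub>i\<^sub>+\<^sub>1\<close> maps \<open>\<mm>F\<^sub>i\<close> to \<open>\<mm>F\<^sub>i\<^sub>+\<^sub>1\<close>; thus the image of a basis element
    is also that of an element of \<open>\<mm>F\<^sub>i\<^sub>+\<^sub>1\<close>.\<close>
  obtain g' where g': "g' \<in> mod_hom R (free_module R (res_rank R M i)) ?E1"
    and dg': "\<And>a. a \<in> carrier ?E0 \<Longrightarrow> ?d (g' a) = g a"
    using free_hom_lift[OF res_module_module K dK res_diff_surj[OF M], of g "res_rank R M i"] g
    unfolding res_module_eq by blast
  let ?e = "unit_vec ?b 0"
  have e: "?e \<in> carrier ?E1" by (simp add: res_module_eq)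
  have "?d ?e \<in> carrier ?K" by (rule mod_hom_closed[OF dK e])
  then have dm: "?d ?e \<in> {..<res_rank R M i} \<rightarrow>\<^sub>E \<mm>" "?d ?e \<in> carrier ?E0"
    using syzygy_Suc_minimal[OF M, of i] syzygy_Suc_subset[OF M, of i] by auto
  have "g' (?d ?e) \<in> {..<?b} \<rightarrow>\<^sub>E \<mm>"
    using free_hom_maximal_ideal[OF _ dm(1)] g' by (simp only: res_module_eq)
  then have "?d (g' (?d ?e)) \<noteq> ?d ?e"
    using minimal_free_cover_basis_image[OF K res_diff_minimal_free_cover[OF M]] nz by simp
  then show False using dg'[OF dm(2)] gd[OF e] by simp
qed

text \<open>
  If the resolution ends in degree \<open>k + 1\<close>, then every map \<open>F\<^sub>k\<^sub>+\<^sub>1 \<rightarrow> M\<close> is a cocycle, whereas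
  coboundaries take values in \<open>\<mm>M\<close>. A cocycle sending a basis element to a minimal generator of \<open>M\<close>
  is therefore not a coboundary.
\<close>

lemma res_rank_descend:
  assumes M: "fg_module R M" and ext: "Ext_zero R (Suc k) M M"
    and last: "res_rank R M (Suc (Suc k)) = 0"
  shows "res_rank R M (Suc k) = 0 \<or> res_rank R M 0 = 0"
proof (rule ccontr)
  assume "\<not> (res_rank R M (Suc k) = 0 \<or> res_rank R M 0 = 0)"
  then have b: "0 < res_rank R M (Suc k)" and b0: "0 < res_rank R M 0" by auto
  let ?E0 = "res_module R M k" and ?E1 = "res_module R M (Suc k)" and ?E2 = "res_module R M (Suc (Suc k))"
  let ?d = "res_diff R M k"
  let ?b = "res_rank R M (Suc k)" and ?a = "res_rank R M 0"
  define p where "p = snd (cover R M)"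
  have Mm: "module R M" using M by (simp add: fg_module_def)
  interpret M: module R M by (rule Mm)
  have cov: "minimal_free_cover R M ?a p"
    using cover_minimal_free_cover[OF M] by (simp add: p_def res_rank_def)
  then have p: "p \<in> mod_hom R (free_module R ?a) M" and surj: "p ` carrier (free_module R ?a) = carrier M"
    by (simp_all add: minimal_free_cover_def)
  have ext': "extends_from_image R ?E1 ?E0 ?d M" using ext by (simp only: Ext_zero_iff_extends[OF M Mm])
  have "p (unit_vec ?a 0) \<in> carrier M" by (rule mod_hom_closed[OF p]) simp
  then obtain f where f: "f \<in> mod_hom R ?E1 M" and fe: "f (unit_vec ?b 0) = p (unit_vec ?a 0)"
    using free_hom_exists[OF Mm, of ?b "\<lambda>_. p (unit_vec ?a 0)"] b unfolding res_module_eq by blast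
  have f0: "f y = \<zero>\<^bsub>M\<^esub>" if y: "y \<in> carrier ?E1" "?d y = \<zero>\<^bsub>?E0\<^esub>" for y
  proof -
    obtain x where x: "x \<in> carrier ?E2" "y = res_diff R M (Suc k) x" using res_exact[OF M y(1)] y(2) by auto
    have "x = \<zero>\<^bsub>?E2\<^esub>" using x(1) last by (simp add: res_module_eq restrict_def)
    then have "y = \<zero>\<^bsub>?E1\<^esub>"
      using x(2) mod_hom_zero[OF res_module_module res_module_module res_diff_hom[OF M]] by simp
    then show ?thesis using mod_hom_zero[OF res_module_module Mm f] by simp
  qed
  obtain g where g: "g \<in> mod_hom R ?E0 M" and gd: "\<And>y. y \<in> carrier ?E1 \<Longrightarrow> f y = g (?d y)"
    using extends_from_imageE[OF ext' f f0] by blast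
  obtain g' where g': "g' \<in> mod_hom R ?E0 (free_module R ?a)"
    and pg': "\<And>a. a \<in> carrier ?E0 \<Longrightarrow> p (g' a) = g a"
    using free_hom_lift[OF free_module_module Mm p surj, of g "res_rank R M k"] g
    unfolding res_module_eq by blast
  let ?e = "unit_vec ?b 0"
  have e: "?e \<in> carrier ?E1" by (simp add: res_module_eq)
  have "?d ?e \<in> carrier (syzygy_Suc R M k)"
    by (rule mod_hom_closed[OF res_diff_onto_syzygy_hom[OF M] e])
  then have dm: "?d ?e \<in> {..<res_rank R M k} \<rightarrow>\<^sub>E \<mm>" "?d ?e \<in> carrier ?E0"
    using syzygy_Suc_minimal[OF M, of k] syzygy_Suc_subset[OF M, of k] by auto
  have "g' (?d ?e) \<in> {..<?a} \<rightarrow>\<^sub>E \<mm>"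
    using free_hom_maximal_ideal[OF _ dm(1)] g' by (simp only: res_module_eq)
  then have "p (g' (?d ?e)) \<noteq> p (unit_vec ?a 0)"
    using minimal_free_cover_basis_image[OF Mm cov b0] by simp
  then show False using pg'[OF dm(2)] gd[OF e] fe by simp
qed

text \<open>In either case the kernel of the minimal cover of \<open>M\<close> is zero; if \<open>F\<^sub>0 = 0\<close>, then \<open>M = 0\<close>.\<close>

lemma is_free_if_short_resolution:
  assumes M: "fg_module R M" and "res_rank R M (Suc 0) = 0 \<or> res_rank R M 0 = 0"
  shows "is_free R M"
proof -
  define b where "b = res_rank R M 0"
  define p where "p = snd (cover R M)"
  let ?F = "free_module R b"
  have Mm: "module R M" using M by (simp add: fg_module_def)
  interpret M: module R M by (rule Mm)
  interpret F: module R ?F by (rule free_module_module)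
  have p: "p \<in> mod_hom R ?F M" and surj: "p ` carrier ?F = carrier M"
    using cover_minimal_free_cover[OF M] by (simp_all add: p_def b_def res_rank_def minimal_free_cover_def)
  have syz: "carrier (syzygy_Suc R M 0) = {x \<in> carrier ?F. p x = \<zero>\<^bsub>M\<^esub>}"
    by (simp add: first_syzygy_carrier p_def b_def res_rank_def)
  have ker: "x = \<zero>\<^bsub>?F\<^esub>" if x: "x \<in> carrier ?F" "p x = \<zero>\<^bsub>M\<^esub>" for x
    using assms(2)
  proof
    assume r: "res_rank R M (Suc 0) = 0"
    have "x \<in> res_diff R M 0 ` carrier (res_module R M (Suc 0))"
      unfolding res_diff_surj[OF M] using syz x by simp
    then obtain y where y: "y \<in> carrier (res_module R M (Suc 0))" "x = res_diff R M 0 y" by auto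
    have "y = \<zero>\<^bsub>res_module R M (Suc 0)\<^esub>" using y(1) r by (simp add: res_module_eq restrict_def)
    then have "x = \<zero>\<^bsub>res_module R M 0\<^esub>"
      using y(2) mod_hom_zero[OF res_module_module res_module_module res_diff_hom[OF M]] by simp
    then show ?thesis by (simp add: res_module_eq b_def)
  next
    assume "res_rank R M 0 = 0"
    then show ?thesis using x(1) by (simp add: b_def restrict_def)
  qed
  have "inj_on p (carrier ?F)"
  proof (rule inj_onI)
    fix x y assume x: "x \<in> carrier ?F" and y: "y \<in> carrier ?F" and eq: "p x = p y"
    have "p (x \<ominus>\<^bsub>?F\<^esub> y) = \<zero>\<^bsub>M\<^esub>"
      unfolding mod_hom_minus[OF free_module_module Mm p x y] eq
      using mod_hom_closed[OF p y] by (simp add: a_minus_def M.r_neg)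
    then have "x \<ominus>\<^bsub>?F\<^esub> y = \<zero>\<^bsub>?F\<^esub>" using ker[OF F.minus_closed[OF x y]] by simp
    then show "x = y"
      using F.minus_equality[of x "\<ominus>\<^bsub>?F\<^esub> y"] F.minus_minus[OF y] x F.a_inv_closed[OF y]
      unfolding a_minus_def by metis
  qed
  then show ?thesis
    unfolding is_free_def mod_iso_def using p surj by (auto simp: bij_betw_def)
qed

text \<open>\<open>Ext\<^sup>i(M, R)\<close> is \<open>Ext\<^sup>i\<^sup>-\<^sup>n(\<Omega>\<^sup>nM, R)\<close> for \<open>i > n\<close>, and \<open>\<Omega>\<^sup>nM\<close> is totally reflexive.\<close>

lemma Ext_zero_self_above_G_dim:
  assumes "G_dim_le R M n" "n < i"
  shows "Ext_zero R i M (self_module R)"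
proof (cases n)
  case 0
  then show ?thesis using assms by (simp add: G_dim_le_def totally_reflexive_def)
next
  case (Suc k)
  define j where "j = i - Suc (Suc k)"
  have i: "i = Suc (Suc (k + j))" using assms(2) Suc by (simp add: j_def)
  have "Ext_zero R (Suc j) (syzygy_Suc R M k) (self_module R)"
    using assms(1) Suc by (simp add: G_dim_le_def totally_reflexive_def)
  then show ?thesis by (simp only: i Ext_syzygy_Suc)
qed

end

section \<open>Modules of finite AB-dimension without self-extensions\<close>

theorem theorem1p3:
  fixes R :: "'a ring" and M :: "('a, 'b) module"
  assumes "noetherian_local_ring R"
    and "fg_module R M"
    and "AB_dim R M < \<infinity>"
    and "\<And>i. i > 0 \<Longrightarrow> Ext_zero R i M M"
  shows "is_free R M"
proof -
  interpret local_base R by (rule local_base.intro) (rule assms(1))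
  note M = assms(2)
  have G: "G_dim R M < \<infinity>" and P: "P1 R M < \<infinity>" using assms(3) unfolding AB_dim_def by (simp_all only: max_less_iff_conj)
  obtain n where n: "G_dim_le R M n"
    using G by (cases "{n. G_dim_le R M n} = {}") (auto simp: G_dim_def top_ereal_def)
  obtain b :: nat where b: "P1 R M < ereal (real b)"
    using P less_PInf_Ex_of_nat by auto
  have van: "Ext_zero R i M (self_module R)" if "n < i" for i
    by (rule Ext_zero_self_above_G_dim[OF n that])
  have shift: "Ext_zero R (Suc (Suc i)) M (syzygy_Suc R M (Suc j)) \<longleftrightarrow> Ext_zero R (Suc i) M (syzygy_Suc R M j)"
    if "n \<le> i" for i j
    using Ext_zero_shift[OF M fg_syzygy_Suc[OF M] van van, of i j] that by simp
  \<comment> \<open>Upward: starting from \<open>Ext(M, M)\<close>, all syzygies of \<open>M\<close> lie in \<open>M\<^sup>\<bottom>\<close>, with a bound that grows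
    with \<open>j\<close>.\<close>
  have "Ext_zero R i M (syzygy_Suc R M j)" if "n + Suc j < i" for i j
    using that
  proof (induction j arbitrary: i)
    case 0
    then obtain i' where i': "i = Suc (Suc i')" "n \<le> i'" by (cases i; cases "i - 1") auto
    then show ?case using Ext_zero_shift[OF M M van van, of i'] assms(4)[of "Suc i'"] by simp
  next
    case (Suc j)
    then obtain i' where i': "i = Suc (Suc i')" "n + Suc j < Suc i'" by (cases i; cases "i - 1") auto
    then show ?case using shift[of i' j] Suc.IH[of "Suc i'"] by simp
  qed
  then have "syzygy_Suc R M j \<in> perp R M" for j
    unfolding perp_def using fg_syzygy_Suc[OF M] by (auto intro!: exI[of _ "Suc (n + Suc j)"])
  then have "P2 R M (syzygy_Suc R M j) \<le> P1 R M" for j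
    unfolding P1_def by (rule SUP_upper)
  \<comment> \<open>Finiteness of the AB-dimension replaces these bounds by a single one.\<close>
  then have bound: "Ext_zero R i M (syzygy_Suc R M j)" if "b \<le> i" for i j
  proof -
    have "P2 R M (syzygy_Suc R M j) < ereal (real i)"
      using \<open>P2 R M (syzygy_Suc R M j) \<le> P1 R M\<close> b that
      by (meson ereal_less_eq(3) of_nat_le_iff order.strict_trans2 order_le_less_trans)
    then show ?thesis
      unfolding P2_def using SUP_upper[of i "{n. \<not> Ext_zero R n M (syzygy_Suc R M j)}" "\<lambda>n. ereal (real n)"]
      by (metis (no_types, lifting) leD mem_Collect_eq)
  qed
  \<comment> \<open>Downward: with a uniform bound, shifting back from a high degree reaches \<open>n + 1\<close>.\<close>
  have "Ext_zero R (Suc (n + t)) M (syzygy_Suc R M (n + t)) \<Longrightarrow> Ext_zero R (Suc n) M (syzygy_Suc R M n)" for t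
    by (induction t) (use shift in auto)
  then have "Ext_zero R (Suc n) M (syzygy_Suc R M n)" using bound[of "Suc (n + b)" "n + b"] by simp
  then have "res_rank R M (Suc n) = 0" by (rule syzygy_vanishes_if_split[OF M])
  then show ?thesis
  proof (induction n)
    case 0
    then show ?case using is_free_if_short_resolution[OF M] by simp
  next
    case (Suc k)
    have "Ext_zero R (Suc k) M M" using assms(4)[of "Suc k"] by simp
    from res_rank_descend[OF M this Suc.prems] show ?case
    proof
      assume "res_rank R M (Suc k) = 0"
      then show ?thesis by (rule Suc.IH)
    next
      assume "res_rank R M 0 = 0"
      then show ?thesis using is_free_if_short_resolution[OF M] by simp
    qed
  qed
qed

end
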